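(* There exist topologically distinct families of special Lagrangian submanifolds in the completely solvable 6-dimensional Nakamura manifold $N$; that is, there are two families of special Lagrangian submanifolds of $N$ such that no member of the first is homeomorphic to a member of the second.
   Context: Completely solvable Nakamura manifold $N$. Let $\lambda\in\mathbb R\setminus\{0\}$, $M\in SL(2,\mathbb Z)$ and $P\in GL(2,\mathbb R)$ with $PMP^{-1}=\mathrm{diag}(e^{\lambda},e^{-\lambda})$, and $\tau\in\mathbb R\setminus\{0\}$. Let $G=\mathbb C\ltimes_\rho\mathbb C^2$ with coordinates $(w,z_1,z_2)$, $w=x+iy$, $z_k=x_k+iy_k$, and product $(w',z_1',z_2')*(w,z_1,z_2)=(w'+w,\,e^{\lambda\mathrm{Re}\,w'}z_1+z_1',\,e^{-\lambda\mathrm{Re}\,w'}z_2+z_2')$. Let $\Gamma=(\mathbb Z\oplus\tau\sqrt{-1}\,\mathbb Z)\ltimes_\rho(P\mathbb Z^2\oplus\sqrt{-1}P\mathbb Z^2)$ and $N=\Gamma\backslash G$. Global $(1,0)$-co-frame: $\varphi^0=dw=\theta^1+i\theta^4$, $\varphi^1=e^{-\lambda x}dz_1=\theta^2+i\theta^5$, $\varphi^2=e^{\lambda x}dz_2=\theta^3+i\theta^6$. $\Omega=\varphi^0\wedge\varphi^1\wedge\varphi^2$, $\omega=\theta^1\wedge\theta^4+\theta^2\wedge\theta^5+\theta^3\wedge\theta^6$. An oriented 3-submanifold $L$ is special Lagrangian if for some constant angle $\vartheta$ one has $\omega|_L=0$ and $\mathrm{Im}(e^{-i\vartheta}\Omega)|_L=0$.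 *)

theory Defs
  imports "HOL-Analysis.Analysis" "HOL-Algebra.Coset"
begin

type_synonym C3 = "complex \<times> complex \<times> complex"

definition nak_group :: "real \<Rightarrow> C3 monoid" where
  "nak_group l = \<lparr>carrier = UNIV,
     monoid.mult = (\<lambda>(w', z1', z2') (w, z1, z2).
       (w' + w, of_real (exp (l * Re w')) * z1 + z1', of_real (exp (- l * Re w')) * z2 + z2')),
     one = (0, 0, 0)\<rparr>"

definition lattice2 :: "real^2^2 \<Rightarrow> (real^2) set" where
  "lattice2 P = range (\<lambda>m :: int^2. P *v (\<chi> i. of_int (m $ i)))"

definition nak_lattice :: "real \<Rightarrow> real^2^2 \<Rightarrow> C3 set" where
  "nak_lattice \<tau> P = {(w, z1, z2).
     Re w \<in> \<int> \<and> (\<exists>n :: int. Im w = \<tau> * of_int n) \<and>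
     vector [Re z1, Re z2] \<in> lattice2 P \<and> vector [Im z1, Im z2] \<in> lattice2 P}"

text \<open>The points of \<open>\<Gamma>\<setminus>G\<close> are the sets \<open>\<Gamma> * g\<close>, which \<open>HOL-Algebra\<close> calls right cosets.\<close>

definition nak_proj :: "real \<Rightarrow> real \<Rightarrow> real^2^2 \<Rightarrow> C3 \<Rightarrow> C3 set" where
  "nak_proj l \<tau> P g = nak_lattice \<tau> P #>\<^bsub>nak_group l\<^esub> g"

definition nakamura :: "real \<Rightarrow> real \<Rightarrow> real^2^2 \<Rightarrow> C3 set topology" where
  "nakamura l \<tau> P = topology (\<lambda>V. V \<subseteq> rcosets\<^bsub>nak_group l\<^esub> (nak_lattice \<tau> P) \<and>
                                 open {g. nak_proj l \<tau> P g \<in> V})"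

lemma openin_nakamura:
  "openin (nakamura l \<tau> P) V \<longleftrightarrow>
     V \<subseteq> rcosets\<^bsub>nak_group l\<^esub> (nak_lattice \<tau> P) \<and> open {g. nak_proj l \<tau> P g \<in> V}"
proof -
  let ?R = "rcosets\<^bsub>nak_group l\<^esub> (nak_lattice \<tau> P)"
  have Int: "{g. nak_proj l \<tau> P g \<in> S \<inter> T}
      = {g. nak_proj l \<tau> P g \<in> S} \<inter> {g. nak_proj l \<tau> P g \<in> T}" for S T by auto
  have Un: "{g. nak_proj l \<tau> P g \<in> \<Union>K} = (\<Union>V\<in>K. {g. nak_proj l \<tau> P g \<in> V})" for K by auto
  have "istopology (\<lambda>V. V \<subseteq> ?R \<and> open {g. nak_proj l \<tau> P g \<in> V})"
    unfolding istopology_def Int Un by (auto intro!: open_Int open_UN)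
  then show ?thesis
    by (simp add: nakamura_def topology_inverse')
qed

lemma range_nak_proj: "range (nak_proj l \<tau> P) = rcosets\<^bsub>nak_group l\<^esub> (nak_lattice \<tau> P)"
  by (auto simp: nak_proj_def RCOSETS_def nak_group_def)

lemma topspace_nakamura: "topspace (nakamura l \<tau> P) = rcosets\<^bsub>nak_group l\<^esub> (nak_lattice \<tau> P)"
proof -
  let ?R = "rcosets\<^bsub>nak_group l\<^esub> (nak_lattice \<tau> P)"
  have "{g. nak_proj l \<tau> P g \<in> ?R} = UNIV"
    using range_nak_proj[of l \<tau> P] by auto
  then have "openin (nakamura l \<tau> P) ?R"
    by (simp add: openin_nakamura)
  then show ?thesis
    by (meson openin_nakamura openin_subset openin_topspace subset_antisym)
qed

lemma quotient_map_nak_proj: "quotient_map euclidean (nakamura l \<tau> P) (nak_proj l \<tau> P)"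
  unfolding quotient_map_def topspace_nakamura
  using range_nak_proj[of l \<tau> P] by (auto simp: openin_nakamura)

lemma group_nak_group: "group (nak_group l)"
proof (rule groupI)
  fix x assume "x \<in> carrier (nak_group l)"
  obtain w z1 z2 where x: "x = (w, z1, z2)" by (cases x)
  show "\<exists>y\<in>carrier (nak_group l). y \<otimes>\<^bsub>nak_group l\<^esub> x = \<one>\<^bsub>nak_group l\<^esub>"
    by (rule bexI[of _ "(- w, - of_real (exp (- l * Re w)) * z1, - of_real (exp (l * Re w)) * z2)"])
       (auto simp: x nak_group_def)
qed (auto simp: nak_group_def algebra_simps exp_add exp_diff exp_minus field_simps)

text \<open>A 1-form on \<open>G\<close> is a function of a point and a tangent vector. All forms below are
  invariant under left translations, so they are the pull-backs of the corresponding forms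
  on the quotient.\<close>

definition coframe0 :: "C3 \<Rightarrow> C3 \<Rightarrow> complex" where
  "coframe0 = (\<lambda>g (dw, dz1, dz2). dw)"

definition coframe1 :: "real \<Rightarrow> C3 \<Rightarrow> C3 \<Rightarrow> complex" where
  "coframe1 l = (\<lambda>(w, z1, z2) (dw, dz1, dz2). of_real (exp (- l * Re w)) * dz1)"

definition coframe2 :: "real \<Rightarrow> C3 \<Rightarrow> C3 \<Rightarrow> complex" where
  "coframe2 l = (\<lambda>(w, z1, z2) (dw, dz1, dz2). of_real (exp (l * Re w)) * dz2)"

definition wedge2 :: "('a \<Rightarrow> 'b::comm_ring_1) \<Rightarrow> ('a \<Rightarrow> 'b) \<Rightarrow> 'a \<Rightarrow> 'a \<Rightarrow> 'b" where
  "wedge2 \<alpha> \<beta> u v = \<alpha> u * \<beta> v - \<alpha> v * \<beta> u"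

definition wedge3 ::
    "('a \<Rightarrow> 'b::comm_ring_1) \<Rightarrow> ('a \<Rightarrow> 'b) \<Rightarrow> ('a \<Rightarrow> 'b) \<Rightarrow> 'a \<Rightarrow> 'a \<Rightarrow> 'a \<Rightarrow> 'b" where
  "wedge3 \<alpha> \<beta> \<gamma> u v w =
     det (vector [vector [\<alpha> u, \<alpha> v, \<alpha> w], vector [\<beta> u, \<beta> v, \<beta> w], vector [\<gamma> u, \<gamma> v, \<gamma> w]] :: 'b^3^3)"

definition nak_omega :: "real \<Rightarrow> C3 \<Rightarrow> C3 \<Rightarrow> C3 \<Rightarrow> real" where
  "nak_omega l g u v =
     wedge2 (Re \<circ> coframe0 g) (Im \<circ> coframe0 g) u v
   + wedge2 (Re \<circ> coframe1 l g) (Im \<circ> coframe1 l g) u v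
   + wedge2 (Re \<circ> coframe2 l g) (Im \<circ> coframe2 l g) u v"

definition nak_Omega :: "real \<Rightarrow> C3 \<Rightarrow> C3 \<Rightarrow> C3 \<Rightarrow> C3 \<Rightarrow> complex" where
  "nak_Omega l g = wedge3 (coframe0 g) (coframe1 l g) (coframe2 l g)"

text \<open>The differential of left translation by \<open>(a, b, c)\<close> is the linear map in the
  tangent argument.\<close>

lemma coframe_invariant:
  fixes l :: real and a b c :: complex
  defines "dL \<equiv> \<lambda>(dw, dz1, dz2). (dw, of_real (exp (l * Re a)) * dz1, of_real (exp (- l * Re a)) * dz2)"
  shows "((\<otimes>\<^bsub>nak_group l\<^esub>) (a, b, c) has_derivative dL) (at g)"
    and "coframe0 ((a, b, c) \<otimes>\<^bsub>nak_group l\<^esub> g) (dL v) = coframe0 g v"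
    and "coframe1 l ((a, b, c) \<otimes>\<^bsub>nak_group l\<^esub> g) (dL v) = coframe1 l g v"
    and "coframe2 l ((a, b, c) \<otimes>\<^bsub>nak_group l\<^esub> g) (dL v) = coframe2 l g v"
proof -
  have 1: "(\<otimes>\<^bsub>nak_group l\<^esub>) (a, b, c) = (\<lambda>g. (a + fst g,
      of_real (exp (l * Re a)) * fst (snd g) + b, of_real (exp (- l * Re a)) * snd (snd g) + c))"
    by (auto simp: nak_group_def fun_eq_iff)
  have 2: "dL = (\<lambda>v. (fst v, of_real (exp (l * Re a)) * fst (snd v),
      of_real (exp (- l * Re a)) * snd (snd v)))"
    by (auto simp: dL_def fun_eq_iff)
  show "((\<otimes>\<^bsub>nak_group l\<^esub>) (a, b, c) has_derivative dL) (at g)"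
    unfolding 1 2 by (auto intro!: derivative_eq_intros)
  show "coframe0 ((a, b, c) \<otimes>\<^bsub>nak_group l\<^esub> g) (dL v) = coframe0 g v"
    by (auto simp: coframe0_def dL_def split: prod.splits)
  show "coframe1 l ((a, b, c) \<otimes>\<^bsub>nak_group l\<^esub> g) (dL v) = coframe1 l g v"
    by (cases g; cases v)
       (simp add: coframe1_def dL_def nak_group_def flip: of_real_mult exp_add mult.assoc,
        simp add: algebra_simps)
  show "coframe2 l ((a, b, c) \<otimes>\<^bsub>nak_group l\<^esub> g) (dL v) = coframe2 l g v"
    by (cases g; cases v)
       (simp add: coframe2_def dL_def nak_group_def flip: of_real_mult exp_add mult.assoc,
        simp add: algebra_simps)
qed

fun Ck_on :: "nat \<Rightarrow> ('a::euclidean_space \<Rightarrow> 'b::real_normed_vector) \<Rightarrow> 'a set \<Rightarrow> bool" where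
  "Ck_on 0 f S \<longleftrightarrow> continuous_on S f"
| "Ck_on (Suc k) f S \<longleftrightarrow>
     f differentiable_on S \<and> (\<forall>v. Ck_on k (\<lambda>x. frechet_derivative f (at x) v) S)"

text \<open>Only used on open sets, where the Frechet derivative is unique.\<close>

definition smooth_on :: "'a::euclidean_space set \<Rightarrow> ('a \<Rightarrow> 'b::real_normed_vector) \<Rightarrow> bool" where
  "smooth_on S f \<longleftrightarrow> (\<forall>k. Ck_on k f S)"

text \<open>The projection from \<open>G\<close> is the universal covering of the quotient and defines its smooth
  structure. A local parametrisation of a subset of the quotient is therefore given by a lift
  \<open>f\<close> with values in \<open>G\<close>: the smooth map into the quotient is \<open>nak_proj l \<tau> P \<circ> f\<close>, an immersion
  which is a homeomorphism onto a relatively open subset of \<open>L\<close>.\<close>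

definition local_param ::
    "real \<Rightarrow> real \<Rightarrow> real^2^2 \<Rightarrow> C3 set set \<Rightarrow> (real^3) set \<Rightarrow> (real^3 \<Rightarrow> C3) \<Rightarrow> bool" where
  "local_param l \<tau> P L U f \<longleftrightarrow>
     open U \<and> smooth_on U f \<and> (\<forall>u\<in>U. inj (frechet_derivative f (at u))) \<and>
     openin (subtopology (nakamura l \<tau> P) L) ((nak_proj l \<tau> P \<circ> f) ` U) \<and>
     homeomorphic_map (top_of_set U)
       (subtopology (nakamura l \<tau> P) ((nak_proj l \<tau> P \<circ> f) ` U)) (nak_proj l \<tau> P \<circ> f)"

text \<open>An embedded 3-dimensional submanifold \<open>L\<close> (without boundary) with orientation given by the
  atlas \<open>A\<close>: the transition maps between its parametrisations have positive Jacobian.\<close>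

definition oriented_submanifold ::
    "real \<Rightarrow> real \<Rightarrow> real^2^2 \<Rightarrow> C3 set set \<Rightarrow> ((real^3) set \<times> (real^3 \<Rightarrow> C3)) set \<Rightarrow> bool" where
  "oriented_submanifold l \<tau> P L A \<longleftrightarrow>
     (\<forall>(U, f)\<in>A. local_param l \<tau> P L U f) \<and>
     L = (\<Union>(U, f)\<in>A. (nak_proj l \<tau> P \<circ> f) ` U) \<and>
     (\<forall>(U, f)\<in>A. \<forall>(V, g)\<in>A. \<forall>v\<in>V. nak_proj l \<tau> P (g v) \<in> (nak_proj l \<tau> P \<circ> f) ` U \<longrightarrow>
        (\<exists>D. ((inv_into U (nak_proj l \<tau> P \<circ> f) \<circ> (nak_proj l \<tau> P \<circ> g)) has_derivative D) (at v) \<and>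
             det (matrix D) > 0))"

definition special_lagrangian :: "real \<Rightarrow> real \<Rightarrow> real^2^2 \<Rightarrow> C3 set set \<Rightarrow> bool" where
  "special_lagrangian l \<tau> P L \<longleftrightarrow>
     (\<exists>A. oriented_submanifold l \<tau> P L A \<and>
       (\<exists>\<theta>::real. \<forall>(U, f)\<in>A. \<forall>u\<in>U. \<forall>a b c. let D = frechet_derivative f (at u) in
          nak_omega l (f u) (D a) (D b) = 0 \<and>
          Im (cis (- \<theta>) * nak_Omega l (f u) (D a) (D b) (D c)) = 0))"

text \<open>A smooth one-parameter family of pairwise distinct closed (compact, connected, non-empty)
  special Lagrangian submanifolds: locally, the members are parametrised by maps depending
  smoothly on the point and on the parameter.\<close>

definition special_lagrangian_family ::
    "real \<Rightarrow> real \<Rightarrow> real^2^2 \<Rightarrow> real set \<Rightarrow> (real \<Rightarrow> C3 set set) \<Rightarrow> bool" where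
  "special_lagrangian_family l \<tau> P T L \<longleftrightarrow>
     open T \<and> connected T \<and> T \<noteq> {} \<and> inj_on L T \<and>
     (\<forall>t\<in>T. special_lagrangian l \<tau> P (L t) \<and> L t \<noteq> {} \<and>
            compactin (nakamura l \<tau> P) (L t) \<and> connectedin (nakamura l \<tau> P) (L t)) \<and>
     (\<forall>t\<in>T. \<forall>p\<in>L t. \<exists>J U F. open J \<and> t \<in> J \<and> J \<subseteq> T \<and> smooth_on (J \<times> U) F \<and>
        (\<forall>s\<in>J. local_param l \<tau> P (L s) U (\<lambda>u. F (s, u))) \<and>
        p \<in> (\<lambda>u. nak_proj l \<tau> P (F (t, u))) ` U)"

end

theory Submission
  imports Defs
begin

text \<open>The real part of the two complex coordinates \<open>z\<^sub>1, z\<^sub>2\<close> together with one of the two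
  directions \<open>y = Im w\<close> and \<open>x = Re w\<close> spans, at every point, a Lagrangian 3-plane on which
  \<open>\<Omega>\<close> has constant phase, because \<open>\<phi>\<^sup>1, \<phi>\<^sup>2\<close> are real on it and \<open>\<phi>\<^sup>0\<close> is real up to the
  constant factor \<open>\<i>\<close> or \<open>1\<close>. The integral leaves through \<open>Im z\<^sub>1 = Im z\<^sub>2 = 0\<close> are compact:
  \<^item> for the direction \<open>y\<close>, the leaf over a fixed \<open>x\<close> is a torus, the quotient of \<open>\<real>\<^sup>3\<close> by the
    translations in \<open>\<tau>\<int> \<times> P\<int>\<^sup>2\<close>;
  \<^item> for the direction \<open>x\<close>, the leaf over a fixed \<open>y\<close> is the mapping torus of \<open>M\<close>: going once
    around \<open>x\<close> acts on the fibre by \<open>D = diag(e\<^sup>l, e\<^sup>-\<^sup>l)\<close>.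

  Letting the fixed coordinate vary gives the two families. Both cases are treated at once, by a parameter
  \<open>\<beta> \<in> {\<i>, 1}\<close> that gives the direction in the \<open>w\<close>-plane. The leaf is the image of the affine
  slice \<open>u \<mapsto> (\<beta> (u\<^sub>1 + \<i>s), u\<^sub>2, u\<^sub>3)\<close>, which is a covering onto it; its deck transformations are
  the affine maps induced by the elements of \<open>\<Gamma>\<close> that preserve the slice. They have
  Jacobian \<open>1\<close>, so restrictions of the slice to small balls form an oriented atlas
  (\<open>special_lagrangian_leaf\<close>, \<open>special_lagrangian_family_leaf\<close>).

  The leaves are distinguished by the rank of the group of homotopy classes of maps to
  \<open>\<complex> - {0}\<close>, that is, by their first Betti number, which is \<open>3\<close> for the torus and \<open>1\<close> for
  the mapping torus. The property \<open>log_dependent\<close> says that this rank is at most \<open>1\<close>. A map from a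
  leaf to \<open>\<complex> - {0}\<close> has a logarithm on the covering space \<open>\<real>\<^sup>3\<close>, and the increments of the
  logarithm under deck transformations form a homomorphism \<open>\<nu>\<close> from the deck group to \<open>\<int>\<close>.
  For the mapping torus, \<open>\<nu>\<close> is invariant under conjugation, hence under \<open>D\<close> on the
  fibre lattice. As \<open>D v + D\<^sup>-\<^sup>1 v = k v\<close> with the integer \<open>k = e\<^sup>l + e\<^sup>-\<^sup>l > 2\<close>, this gives
  \<open>k \<nu>(v) = 2 \<nu>(v)\<close>, so \<open>\<nu>\<close> vanishes on the lattice (\<open>mapping_torus_log\<close>) and only the base
  circle contributes. On the torus, two of the angular coordinates are independent
  (\<open>torus_not_log_dependent\<close>).\<close>

section \<open>The lattice\<close>

lemma vector2_eq_iff: "(vector [a, b] :: 'a::zero^2) = vector [c, d] \<longleftrightarrow> a = c \<and> b = d"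
  by (metis vector_2)

lemma vector2_collapse: "(vector [v $ 1, v $ 2] :: 'a::zero^2) = v"
  by (simp add: vec_eq_iff forall_2)

lemma vector3_eq_iff:
  "(v :: 'a::zero^3) = vector [a, b, c] \<longleftrightarrow> v $ 1 = a \<and> v $ 2 = b \<and> v $ 3 = c"
  by (simp add: vec_eq_iff forall_3)

locale nakamura_data =
  fixes l \<tau> :: real and M :: "int^2^2" and P :: "real^2^2"
  assumes l_nonzero: "l \<noteq> 0" and tau_nonzero: "\<tau> \<noteq> 0" and invertible_P: "invertible P"
    and conj_diag: "P ** (\<chi> i j. of_int (M $ i $ j)) ** matrix_inv P
           = vector [vector [exp l, 0], vector [0, exp (- l)]]"
begin

abbreviation "lat x y \<equiv> vector [x, y] \<in> lattice2 P"

lemma lat_zero: "lat 0 0"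
proof -
  have "(vector [0, 0] :: real^2) = P *v (\<chi> i. of_int ((0 :: int^2) $ i))"
    by (simp add: vec_eq_iff forall_2 matrix_vector_mult_def)
  then show ?thesis
    unfolding lattice2_def by blast
qed

lemma lat_add:
  assumes "lat x y" "lat x' y'"
  shows "lat (x + x') (y + y')"
proof -
  obtain m n :: "int^2" where m: "vector [x, y] = P *v (\<chi> i. of_int (m $ i))"
    and n: "vector [x', y'] = P *v (\<chi> i. of_int (n $ i))"
    using assms unfolding lattice2_def by blast
  have "(vector [x + x', y + y'] :: real^2) = vector [x, y] + vector [x', y']"
    by (simp add: vec_eq_iff forall_2)
  also have "\<dots> = P *v (\<chi> i. of_int ((m + n) $ i))"
    unfolding m n matrix_vector_right_distrib[symmetric]
    by (rule arg_cong[where f = "(*v) P"]) (simp add: vec_eq_iff)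
  finally show ?thesis
    unfolding lattice2_def by blast
qed

lemma lat_uminus:
  assumes "lat x y"
  shows "lat (- x) (- y)"
proof -
  obtain m :: "int^2" where m: "vector [x, y] = P *v (\<chi> i. of_int (m $ i))"
    using assms unfolding lattice2_def by blast
  have "(vector [- x, - y] :: real^2) = - vector [x, y]"
    by (simp add: vec_eq_iff forall_2)
  also have "\<dots> = P *v (\<chi> i. of_int ((- m) $ i))"
    unfolding m by (simp add: vec_eq_iff matrix_vector_mult_def sum_negf)
  finally show ?thesis
    unfolding lattice2_def by blast
qed

lemma lat_diff: "lat x y \<Longrightarrow> lat x' y' \<Longrightarrow> lat (x - x') (y - y')"
  using lat_add[of x y "- x'" "- y'"] lat_uminus by simp

lemma lat_of_nat_mult: "lat x y \<Longrightarrow> lat (of_nat k * x) (of_nat k * y)"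
  by (induction k) (auto simp: lat_zero algebra_simps intro: lat_add)

lemma lat_of_int_mult: "lat x y \<Longrightarrow> lat (of_int k * x) (of_int k * y)"
  using lat_of_nat_mult[of x y "nat k"] lat_uminus[OF lat_of_nat_mult[of x y "nat (- k)"]]
  by (cases "k \<ge> 0") auto

lemma matrix_inv_P: "matrix_inv P ** P = mat 1" "P ** matrix_inv P = mat 1"
  using someI_ex[OF invertible_P[unfolded invertible_def]] by (auto simp: matrix_inv_def)

text \<open>The sum is the trace of the diagonal matrix, which is conjugate to the integer matrix \<open>M\<close>.\<close>

lemma exp_trace_int: obtains k :: int where "exp l + exp (- l) = of_int k"
proof -
  let ?M = "(\<chi> i j. of_int (M $ i $ j)) :: real^2^2"
  have "exp l + exp (- l) = trace (P ** ?M ** matrix_inv P)"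
    by (simp add: conj_diag trace_def sum_2)
  also have "\<dots> = trace (matrix_inv P ** (P ** ?M))"
    by (rule trace_mul_sym)
  also have "\<dots> = trace ?M"
    by (simp add: matrix_mul_assoc matrix_inv_P)
  also have "\<dots> = of_int (M $ 1 $ 1 + M $ 2 $ 2)"
    by (simp add: trace_def sum_2)
  finally show ?thesis
    by (rule that)
qed

text \<open>On the lattice \<open>P\<int>\<^sup>2\<close> the diagonal matrix acts as \<open>M\<close> does on \<open>\<int>\<^sup>2\<close>.\<close>

lemma lat_exp:
  assumes "lat x y"
  shows "lat (exp l * x) (exp (- l) * y)"
proof -
  let ?M = "(\<chi> i j. of_int (M $ i $ j)) :: real^2^2"
  obtain m :: "int^2" where m: "vector [x, y] = P *v (\<chi> i. of_int (m $ i))"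
    using assms unfolding lattice2_def by blast
  have "(vector [exp l * x, exp (- l) * y] :: real^2)
      = (vector [vector [exp l, 0], vector [0, exp (- l)]] :: real^2^2) *v vector [x, y]"
    by (simp add: vec_eq_iff forall_2 matrix_vector_mult_def sum_2)
  also have "\<dots> = (P ** ?M ** (matrix_inv P ** P)) *v (\<chi> i. of_int (m $ i))"
    unfolding m conj_diag[symmetric] by (simp add: matrix_vector_mul_assoc matrix_mul_assoc)
  also have "\<dots> = P *v (?M *v (\<chi> i. of_int (m $ i)))"
    by (simp add: matrix_inv_P matrix_vector_mul_assoc)
  also have "?M *v (\<chi> i. of_int (m $ i)) = (\<chi> i. of_int ((M *v m) $ i))"
    by (simp add: vec_eq_iff matrix_vector_mult_def)
  finally show ?thesis
    unfolding lattice2_def by blast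
qed

text \<open>The inverse of \<open>D = diag(e\<^sup>l, e\<^sup>-\<^sup>l)\<close> is its trace minus \<open>D\<close> itself, and the trace is an
  integer, so \<open>D\<^sup>-\<^sup>1\<close> preserves the lattice because \<open>D\<close> does.\<close>

lemma lat_exp_minus:
  assumes "lat x y"
  shows "lat (exp (- l) * x) (exp l * y)"
proof -
  obtain k :: int where k: "exp l + exp (- l) = of_int k"
    by (rule exp_trace_int)
  have "exp (- l) * x = of_int k * x - exp l * x" "exp l * y = of_int k * y - exp (- l) * y"
    by (simp_all add: k[symmetric] algebra_simps)
  then show ?thesis
    using lat_diff[OF lat_of_int_mult[OF assms, of k] lat_exp[OF assms]] by simp
qed

lemma lat_exp_int: "lat x y \<Longrightarrow> lat (exp (l * of_int n) * x) (exp (- l * of_int n) * y)"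
proof (induction n rule: int_induct[where k = 0])
  case (step1 i)
  then show ?case
    using lat_exp[of "exp (l * of_int i) * x" "exp (- l * of_int i) * y"]
    by (simp add: algebra_simps exp_add exp_diff exp_minus field_simps)
next
  case (step2 i)
  then show ?case
    using lat_exp_minus[of "exp (l * of_int i) * x" "exp (- l * of_int i) * y"]
    by (simp add: algebra_simps exp_add exp_diff exp_minus field_simps)
qed simp

lemma norm_vector2_le: "norm (vector [x, y] :: real^2) \<le> \<bar>x\<bar> + \<bar>y\<bar>"
  using norm_le_l1_cart[of "vector [x, y] :: real^2"] by (simp add: sum_2)

lemma lat_discrete:
  obtains \<epsilon> where "\<epsilon> > 0" "\<And>x y. lat x y \<Longrightarrow> \<bar>x\<bar> < \<epsilon> \<Longrightarrow> \<bar>y\<bar> < \<epsilon> \<Longrightarrow> x = 0 \<and> y = 0"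
proof -
  obtain K where K: "K > 0" "\<And>v. norm (matrix_inv P *v v) \<le> norm v * K"
    using bounded_linear.pos_bounded[OF matrix_vector_mul_bounded_linear[of "matrix_inv P"]] by blast
  show ?thesis
  proof (rule that[of "1 / (2 * K)"])
    fix x y assume lat: "lat x y" and xy: "\<bar>x\<bar> < 1 / (2 * K)" "\<bar>y\<bar> < 1 / (2 * K)"
    obtain m :: "int^2" where m: "vector [x, y] = P *v (\<chi> i. of_int (m $ i))"
      using lat unfolding lattice2_def by blast
    have "(\<chi> i. of_int (m $ i)) = matrix_inv P *v vector [x, y]"
      unfolding m by (simp add: matrix_vector_mul_assoc matrix_inv_P)
    then have "norm ((\<chi> i. of_int (m $ i)) :: real^2) \<le> norm (vector [x, y] :: real^2) * K"
      using K(2) by simp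
    also have "\<dots> \<le> (\<bar>x\<bar> + \<bar>y\<bar>) * K"
      using norm_vector2_le K(1) by (simp add: mult_right_mono)
    also have "\<dots> < (1 / (2 * K) + 1 / (2 * K)) * K"
      using xy K(1) by (intro mult_strict_right_mono) auto
    also have "\<dots> = 1"
      using K(1) by simp
    finally have "norm ((\<chi> i. of_int (m $ i)) :: real^2) < 1" .
    then have "\<bar>real_of_int (m $ i)\<bar> < 1" for i
      using component_le_norm_cart[of "(\<chi> i. of_int (m $ i)) :: real^2" i] by simp
    then have "m $ i = 0" for i
      by (metis of_int_abs of_int_less_1_iff zabs_less_one_iff)
    then have "(vector [x, y] :: real^2) = vector [0, 0]"
      unfolding m by (simp add: vec_eq_iff forall_2 matrix_vector_mult_def)
    then show "x = 0 \<and> y = 0"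
      by (simp add: vector2_eq_iff)
  qed (use K in auto)
qed

lemma lat_cocompact:
  obtains R where "\<And>x y. \<exists>a b. lat a b \<and> \<bar>x + a\<bar> \<le> R \<and> \<bar>y + b\<bar> \<le> R"
proof -
  obtain K where K: "K > 0" "\<And>v. norm (P *v v) \<le> norm v * K"
    using bounded_linear.pos_bounded[OF matrix_vector_mul_bounded_linear[of P]] by blast
  show ?thesis
  proof (rule that[of "2 * K"])
    fix x y :: real
    define v where "v = matrix_inv P *v vector [x, y]"
    define m :: "int^2" where "m = (\<chi> i. - \<lfloor>v $ i\<rfloor>)"
    define ab where "ab = P *v (\<chi> i. of_int (m $ i))"
    have v: "P *v v = vector [x, y]"
      by (simp add: v_def matrix_vector_mul_assoc matrix_inv_P)
    have "P *v (\<chi> i. frac (v $ i)) = P *v (v + (\<chi> i. of_int (m $ i)))"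
      by (rule arg_cong[where f = "(*v) P"]) (simp add: vec_eq_iff m_def frac_def)
    then have eq: "P *v (\<chi> i. frac (v $ i)) = vector [x, y] + ab"
      by (simp add: matrix_vector_right_distrib v ab_def)
    have "norm ((\<chi> i. frac (v $ i)) :: real^2) \<le> 2"
      using norm_le_l1_cart[of "(\<chi> i. frac (v $ i)) :: real^2"]
        frac_lt_1[of "v $ 1"] frac_lt_1[of "v $ 2"] by (simp add: sum_2)
    then have bound: "norm (vector [x, y] + ab) \<le> 2 * K"
      using order_trans[OF K(2) mult_right_mono] K(1) eq by (metis less_imp_le)
    have "lat (ab $ 1) (ab $ 2)"
      unfolding vector2_collapse by (auto simp: ab_def lattice2_def)
    moreover have "\<bar>x + ab $ 1\<bar> \<le> 2 * K" "\<bar>y + ab $ 2\<bar> \<le> 2 * K"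
      using component_le_norm_cart[of "vector [x, y] + ab" 1]
        component_le_norm_cart[of "vector [x, y] + ab" 2] bound by simp_all
    ultimately show "\<exists>a b. lat a b \<and> \<bar>x + a\<bar> \<le> 2 * K \<and> \<bar>y + b\<bar> \<le> 2 * K"
      by blast
  qed
qed

text \<open>The first coordinate with respect to the basis of \<open>\<real>\<^sup>2\<close> given by the columns of \<open>P\<close>;
  modulo \<open>\<int>\<close> it is an angular coordinate on the torus \<open>\<real>\<^sup>2 / P\<int>\<^sup>2\<close>.\<close>

lemma lat_dual:
  obtains \<kappa> :: "real \<Rightarrow> real \<Rightarrow> real" and a b where
    "continuous_on UNIV (\<lambda>u :: real^3. \<kappa> (u $ 2) (u $ 3))"
    "\<And>x y x' y'. \<kappa> (x + x') (y + y') = \<kappa> x y + \<kappa> x' y'"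
    "\<And>x y. lat x y \<Longrightarrow> \<kappa> x y \<in> \<int>" "lat a b" "\<kappa> a b = 1"
proof -
  define Q where "Q = matrix_inv P"
  define \<kappa> where "\<kappa> = (\<lambda>x y. (Q *v vector [x, y]) $ 1)"
  have \<kappa>: "\<kappa> x y = Q $ 1 $ 1 * x + Q $ 1 $ 2 * y" for x y
    by (simp add: \<kappa>_def matrix_vector_mult_def sum_2)
  have P: "Q *v (P *v v) = v" for v
    by (simp add: Q_def matrix_vector_mul_assoc matrix_inv_P)
  have int: "\<kappa> x y \<in> \<int>" if "lat x y" for x y
  proof -
    obtain m :: "int^2" where m: "vector [x, y] = P *v (\<chi> i. of_int (m $ i))"
      using \<open>lat x y\<close> unfolding lattice2_def by blast
    show ?thesis
      unfolding \<kappa>_def m P by simp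
  qed
  define ab where "ab = P *v (\<chi> i. of_int ((vector [1, 0] :: int^2) $ i))"
  have "lat (ab $ 1) (ab $ 2)"
    unfolding vector2_collapse by (auto simp: ab_def lattice2_def)
  moreover have "\<kappa> (ab $ 1) (ab $ 2) = 1"
    unfolding \<kappa>_def vector2_collapse unfolding ab_def P by simp
  ultimately show ?thesis
    using int by (intro that[of \<kappa>]) (auto simp: \<kappa> algebra_simps intro!: continuous_intros)
qed

section \<open>The quotient\<close>

lemma mem_lattice:
  "(a, b, c) \<in> nak_lattice \<tau> P \<longleftrightarrow> Re a \<in> \<int> \<and> (\<exists>n :: int. Im a = \<tau> * of_int n) \<and>
     lat (Re b) (Re c) \<and> lat (Im b) (Im c)"
  by (simp add: nak_lattice_def)

lemma nak_mult:
  "(a, b, c) \<otimes>\<^bsub>nak_group l\<^esub> (w, z1, z2) =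
     (a + w, of_real (exp (l * Re a)) * z1 + b, of_real (exp (- l * Re a)) * z2 + c)"
  by (simp add: nak_group_def)

lemma carrier_nak: "carrier (nak_group l) = UNIV"
  by (simp add: nak_group_def)

lemma lat_exp_Ints: "k \<in> \<int> \<Longrightarrow> lat x y \<Longrightarrow> lat (exp (l * k) * x) (exp (- (l * k)) * y)"
  using lat_exp_int by (auto elim!: Ints_cases)

lemma subgroup_lattice: "subgroup (nak_lattice \<tau> P) (nak_group l)"
proof (rule group.subgroupI[OF group_nak_group])
  show "nak_lattice \<tau> P \<noteq> {}"
    using lat_zero by (auto simp: nak_lattice_def intro!: exI[of _ 0])
next
  fix g assume g: "g \<in> nak_lattice \<tau> P"
  obtain a b c where abc: "g = (a, b, c)" by (cases g)
  obtain n :: int where n: "Im a = \<tau> * of_int n"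
    using g by (auto simp: abc mem_lattice)
  let ?h = "(- a, - of_real (exp (- l * Re a)) * b, - of_real (exp (l * Re a)) * c)"
  have "inv\<^bsub>nak_group l\<^esub> g = ?h"
    using group.inv_equality[OF group_nak_group, of l ?h g]
    by (simp add: abc carrier_nak nak_mult) (simp add: nak_group_def)
  moreover have "?h \<in> nak_lattice \<tau> P"
    using g n lat_uminus[OF lat_exp_Ints[of "- Re a" "Re b" "Re c"]]
      lat_uminus[OF lat_exp_Ints[of "- Re a" "Im b" "Im c"]]
    by (auto simp: abc mem_lattice intro!: exI[of _ "- n"])
  ultimately show "inv\<^bsub>nak_group l\<^esub> g \<in> nak_lattice \<tau> P"
    by simp
next
  fix g h assume gh: "g \<in> nak_lattice \<tau> P" "h \<in> nak_lattice \<tau> P"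
  obtain a b c a' b' c' where abc: "g = (a, b, c)" "h = (a', b', c')"
    by (cases g, cases h)
  obtain n n' :: int where n: "Im a = \<tau> * of_int n" "Im a' = \<tau> * of_int n'"
    using gh by (auto simp: abc mem_lattice)
  show "g \<otimes>\<^bsub>nak_group l\<^esub> h \<in> nak_lattice \<tau> P"
    using gh n lat_add[OF lat_exp_Ints[of "Re a" "Re b'" "Re c'"], of "Re b" "Re c"]
      lat_add[OF lat_exp_Ints[of "Re a" "Im b'" "Im c'"], of "Im b" "Im c"]
    by (auto simp: abc mem_lattice nak_mult algebra_simps intro!: exI[of _ "n + n'"])
qed (simp add: carrier_nak)

lemma nak_proj_eq_iff:
  "nak_proj l \<tau> P g = nak_proj l \<tau> P h \<longleftrightarrow> (\<exists>\<gamma>\<in>nak_lattice \<tau> P. h = \<gamma> \<otimes>\<^bsub>nak_group l\<^esub> g)"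
proof
  assume "nak_proj l \<tau> P g = nak_proj l \<tau> P h"
  then have "h \<in> nak_lattice \<tau> P #>\<^bsub>nak_group l\<^esub> g"
    using group.rcos_self[OF group_nak_group _ subgroup_lattice, of h]
    by (simp add: nak_proj_def carrier_nak)
  then show "\<exists>\<gamma>\<in>nak_lattice \<tau> P. h = \<gamma> \<otimes>\<^bsub>nak_group l\<^esub> g"
    by (auto simp: r_coset_def)
next
  assume "\<exists>\<gamma>\<in>nak_lattice \<tau> P. h = \<gamma> \<otimes>\<^bsub>nak_group l\<^esub> g"
  then have "h \<in> nak_lattice \<tau> P #>\<^bsub>nak_group l\<^esub> g"
    by (auto simp: r_coset_def)
  then show "nak_proj l \<tau> P g = nak_proj l \<tau> P h"
    using group.repr_independence[OF group_nak_group _ _ subgroup_lattice]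
    by (simp add: nak_proj_def carrier_nak)
qed

lemma continuous_map_nak_proj: "continuous_map euclidean (nakamura l \<tau> P) (nak_proj l \<tau> P)"
  by (rule quotient_imp_continuous_map[OF quotient_map_nak_proj])

lemma open_map_nak_proj:
  assumes "open W"
  shows "openin (nakamura l \<tau> P) (nak_proj l \<tau> P ` W)"
proof -
  have "open ((\<lambda>g. \<gamma> \<otimes>\<^bsub>nak_group l\<^esub> g) -` W)" for \<gamma>
  proof -
    obtain a b c where "\<gamma> = (a, b, c)" by (cases \<gamma>)
    then have "(\<lambda>g. \<gamma> \<otimes>\<^bsub>nak_group l\<^esub> g) = (\<lambda>g. (a + fst g,
        of_real (exp (l * Re a)) * fst (snd g) + b, of_real (exp (- l * Re a)) * snd (snd g) + c))"
      by (auto simp: nak_mult)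
    then have "continuous_on UNIV (\<lambda>g. \<gamma> \<otimes>\<^bsub>nak_group l\<^esub> g)"
      by (auto intro!: continuous_intros)
    then show ?thesis
      using assms by (simp add: continuous_on_open_vimage)
  qed
  moreover have "{g. nak_proj l \<tau> P g \<in> nak_proj l \<tau> P ` W}
      = (\<Union>\<gamma>\<in>nak_lattice \<tau> P. (\<lambda>g. \<gamma> \<otimes>\<^bsub>nak_group l\<^esub> g) -` W)"
    by (auto simp: image_iff nak_proj_eq_iff)
  ultimately show ?thesis
    using range_nak_proj[of l \<tau> P] by (auto simp: openin_nakamura)
qed

end

section \<open>Slices\<close>

lemma continuous_on_vector3 [continuous_intros]:
  fixes f g h :: "'a::topological_space \<Rightarrow> real"
  assumes "continuous_on S f" "continuous_on S g" "continuous_on S h"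
  shows "continuous_on S (\<lambda>x. vector [f x, g x, h x] :: real^3)"
proof -
  have "(\<lambda>x. vector [f x, g x, h x] :: real^3)
      = (\<lambda>x. \<chi> i. if i = 1 then f x else if i = 2 then g x else h x)"
    by (auto simp: fun_eq_iff vec_eq_iff forall_3)
  moreover have "continuous_on S (\<lambda>x. \<chi> i::3. if i = 1 then f x else if i = 2 then g x else h x)"
  proof (rule continuous_on_vec_lambda)
    show "continuous_on S (\<lambda>x. if i = 1 then f x else if i = 2 then g x else h x)" for i :: 3
      using assms by (cases "i = 1"; cases "i = 2") auto
  qed
  ultimately show ?thesis
    by (simp only:)
qed

lemma Ck_on_affine:
  fixes A :: "'a::euclidean_space \<Rightarrow> 'b::real_normed_vector"
  assumes "bounded_linear A"
  shows "Ck_on k (\<lambda>x. c + A x) S"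
  using assms
proof (induction k arbitrary: c A)
  case 0
  then show ?case
    by (simp add: continuous_on_add linear_continuous_on)
next
  case (Suc k)
  have der: "((\<lambda>x. c + A x) has_derivative A) (at x within T)" for x T
    using bounded_linear_imp_has_derivative[OF Suc.prems] by (auto intro!: derivative_eq_intros)
  then have "frechet_derivative (\<lambda>x. c + A x) (at x) = A" for x
    by (metis frechet_derivative_at)
  moreover have "Ck_on k (\<lambda>x. A v) S" for v
    using Suc.IH[of "\<lambda>_. 0" "A v"] by simp
  ultimately show ?case
    using der by (simp add: differentiable_on_def differentiable_def) blast
qed

text \<open>The direction of the leaf in the \<open>w\<close>-plane is \<open>\<beta>\<close>, and \<open>s\<close> is the coordinate transversal to
  it. The pair \<open>slice_coord\<close>, \<open>slice_normal\<close> below is a system of real coordinates on \<open>G\<close> in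
  which the slice is given by \<open>slice_normal = (s, 0, 0)\<close>.\<close>

definition slice :: "complex \<Rightarrow> real \<Rightarrow> real^3 \<Rightarrow> C3" where
  "slice \<beta> s u = (\<beta> * Complex (u $ 1) s, of_real (u $ 2), of_real (u $ 3))"

definition slice_tangent :: "complex \<Rightarrow> real^3 \<Rightarrow> C3" where
  "slice_tangent \<beta> a = (\<beta> * of_real (a $ 1), of_real (a $ 2), of_real (a $ 3))"

definition slice_coord :: "complex \<Rightarrow> C3 \<Rightarrow> real^3" where
  "slice_coord \<beta> g = vector [Re (cnj \<beta> * fst g), Re (fst (snd g)), Re (snd (snd g))]"

definition slice_normal :: "complex \<Rightarrow> C3 \<Rightarrow> real^3" where
  "slice_normal \<beta> g = vector [Im (cnj \<beta> * fst g), Im (fst (snd g)), Im (snd (snd g))]"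

lemma slice_affine: "slice \<beta> s u = (\<beta> * \<i> * of_real s, 0, 0) + slice_tangent \<beta> u"
  by (simp add: slice_def slice_tangent_def complex_eq_iff)

lemma bounded_linear_slice_tangent: "bounded_linear (slice_tangent \<beta>)"
  unfolding slice_tangent_def
  by (intro bounded_linear_Pair bounded_linear_mult_right[THEN bounded_linear_compose]
      bounded_linear_of_real[THEN bounded_linear_compose] bounded_linear_vec_nth)

lemma smooth_slice: "smooth_on U (slice \<beta> s)"
  using Ck_on_affine[OF bounded_linear_slice_tangent]
  by (simp add: smooth_on_def slice_affine[abs_def])

lemma smooth_slice_family: "smooth_on U (\<lambda>(s, u). slice \<beta> s u)"
proof -
  define A where "A = (\<lambda>z :: real \<times> (real^3). (\<beta> * \<i> * of_real (fst z), 0 :: complex, 0 :: complex)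
      + slice_tangent \<beta> (snd z))"
  have "bounded_linear A"
    unfolding A_def
    by (intro bounded_linear_add bounded_linear_Pair bounded_linear_zero
        bounded_linear_mult_right[THEN bounded_linear_compose]
        bounded_linear_of_real[THEN bounded_linear_compose] bounded_linear_fst
        bounded_linear_slice_tangent[THEN bounded_linear_compose] bounded_linear_snd)
  moreover have "(\<lambda>(s, u). slice \<beta> s u) = (\<lambda>z. 0 + A z)"
    by (auto simp: A_def slice_affine)
  ultimately show ?thesis
    using Ck_on_affine unfolding smooth_on_def by metis
qed

lemma frechet_derivative_slice: "frechet_derivative (slice \<beta> s) (at u) = slice_tangent \<beta>"
proof -
  have "(slice \<beta> s has_derivative slice_tangent \<beta>) (at u)"
    using bounded_linear_imp_has_derivative[OF bounded_linear_slice_tangent]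
    unfolding slice_affine[abs_def] by (auto intro!: derivative_eq_intros)
  then show ?thesis
    by (metis frechet_derivative_at)
qed

text \<open>The functions \<open>coframe1\<close> and \<open>coframe2\<close> are real on the tangent space of the slice and
  \<open>coframe0\<close> takes its values in the real line spanned by \<open>\<beta>\<close>, so each of the three wedge
  products vanishes.\<close>

lemma slice_omega:
  "nak_omega l (slice \<beta> s u) (slice_tangent \<beta> a) (slice_tangent \<beta> b) = 0"
  by (simp add: nak_omega_def slice_def slice_tangent_def coframe0_def coframe1_def coframe2_def
      wedge2_def algebra_simps)

text \<open>For the same reason \<open>\<Omega>\<close> is a real multiple of \<open>\<beta>\<close>, so the phase is the argument of
  \<open>\<beta>\<close>.\<close>

lemma slice_Omega:
  assumes "\<beta> = 1 \<or> \<beta> = \<i>"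
  shows "Im (cis (- Arg \<beta>) * nak_Omega l (slice \<beta> s u)
      (slice_tangent \<beta> a) (slice_tangent \<beta> b) (slice_tangent \<beta> c)) = 0"
proof -
  have "cis (Arg \<beta>) = \<beta>"
    using assms cis_Arg[of \<beta>] by (auto simp: sgn_eq)
  then have "cis (- Arg \<beta>) * \<beta> = 1"
    by (metis cis_inverse cis_neq_zero left_inverse)
  moreover obtain r where "nak_Omega l (slice \<beta> s u)
      (slice_tangent \<beta> a) (slice_tangent \<beta> b) (slice_tangent \<beta> c) = \<beta> * of_real r"
  proof
    show "nak_Omega l (slice \<beta> s u) (slice_tangent \<beta> a) (slice_tangent \<beta> b) (slice_tangent \<beta> c)
      = \<beta> * of_real (exp (- l * Re (\<beta> * Complex (u $ 1) s)) * exp (l * Re (\<beta> * Complex (u $ 1) s))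
          * det (vector [a, b, c] :: real^3^3))"
      by (simp add: nak_Omega_def wedge3_def slice_def slice_tangent_def coframe0_def
          coframe1_def coframe2_def det_3 algebra_simps)
  qed
  ultimately show ?thesis
    by (simp flip: mult.assoc)
qed

locale nakamura_slice = nakamura_data +
  fixes \<beta> :: complex
  assumes \<beta>: "\<beta> = 1 \<or> \<beta> = \<i>"
begin

lemma cnj_\<beta>: "cnj \<beta> * \<beta> = 1" "\<beta> * cnj \<beta> = 1"
  using \<beta> by auto

lemma slice_coord_slice: "slice_coord \<beta> (slice \<beta> s u) = u"
  by (auto simp: slice_coord_def slice_def vec_eq_iff forall_3 cnj_\<beta> simp flip: mult.assoc)

lemma slice_normal_slice: "slice_normal \<beta> (slice \<beta> s u) = vector [s, 0, 0]"
  by (auto simp: slice_normal_def slice_def vec_eq_iff forall_3 cnj_\<beta> simp flip: mult.assoc)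

lemma slice_of_normal:
  assumes "slice_normal \<beta> g = vector [s, 0, 0]"
  shows "slice \<beta> s (slice_coord \<beta> g) = g"
proof -
  obtain w z1 z2 where g: "g = (w, z1, z2)" by (cases g)
  have "s = Im (cnj \<beta> * w)" "Im z1 = 0" "Im z2 = 0"
    using assms by (auto simp: g slice_normal_def vec_eq_iff forall_3)
  then show ?thesis
    using \<beta> by (auto simp: g slice_def slice_coord_def complex_eq_iff)
qed

text \<open>A common lower bound for the nonzero values of \<open>\<bar>Re w\<bar>\<close> and of \<open>\<bar>Im w\<bar>\<close> on the lattice,
  so that the same bound serves both values of \<open>\<beta>\<close>.\<close>

definition period :: real where "period = min 1 \<bar>\<tau>\<bar>"

lemma period_pos: "period > 0"
  using tau_nonzero by (simp add: period_def)

lemma lattice_period: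
  assumes "(a, b, c) \<in> nak_lattice \<tau> P"
  shows "\<bar>Re (cnj \<beta> * a)\<bar> < period \<Longrightarrow> Re (cnj \<beta> * a) = 0"
    and "\<bar>Im (cnj \<beta> * a)\<bar> < period \<Longrightarrow> Im (cnj \<beta> * a) = 0"
proof -
  have Re: "Re a = 0" if "\<bar>Re a\<bar> < period"
    using assms that by (auto simp: mem_lattice period_def elim!: Ints_cases)
  have Im: "Im a = 0" if less: "\<bar>Im a\<bar> < period"
  proof -
    obtain n :: int where n: "Im a = \<tau> * of_int n"
      using assms by (auto simp: mem_lattice)
    then have "\<bar>\<tau>\<bar> * \<bar>of_int n\<bar> < \<bar>\<tau>\<bar> * 1"
      using less by (simp add: period_def abs_mult)
    then have "n = 0"
      using tau_nonzero by (simp only: mult_less_cancel_left) auto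
    then show ?thesis
      by (simp add: n)
  qed
  show "\<bar>Re (cnj \<beta> * a)\<bar> < period \<Longrightarrow> Re (cnj \<beta> * a) = 0"
    "\<bar>Im (cnj \<beta> * a)\<bar> < period \<Longrightarrow> Im (cnj \<beta> * a) = 0"
    using \<beta> Re Im by auto
qed

text \<open>The elements of \<open>\<Gamma>\<close> whose left translation maps one slice, and then every slice, to itself;
  \<open>deck\<close> is the induced action on the parameter space.\<close>

definition deck_group :: "C3 set" where
  "deck_group = {(a, b, c) \<in> nak_lattice \<tau> P. Im (cnj \<beta> * a) = 0 \<and> Im b = 0 \<and> Im c = 0}"

definition deck :: "C3 \<Rightarrow> real^3 \<Rightarrow> real^3" where
  "deck = (\<lambda>(a, b, c) u. vector [u $ 1 + Re (cnj \<beta> * a),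
     exp (l * Re a) * u $ 2 + Re b, exp (- l * Re a) * u $ 3 + Re c])"

definition slice_proj :: "real \<Rightarrow> real^3 \<Rightarrow> C3 set" where
  "slice_proj s = nak_proj l \<tau> P \<circ> slice \<beta> s"

definition leaf :: "real \<Rightarrow> C3 set set" where
  "leaf s = range (slice_proj s)"

lemma slice_coord_mult:
  "slice_coord \<beta> (\<gamma> \<otimes>\<^bsub>nak_group l\<^esub> slice \<beta> s u) = deck \<gamma> u"
  by (cases \<gamma>)
     (auto simp: slice_coord_def slice_def deck_def nak_mult vec_eq_iff forall_3 cnj_\<beta> algebra_simps
      simp flip: mult.assoc)

lemma slice_normal_mult:
  "slice_normal \<beta> ((a, b, c) \<otimes>\<^bsub>nak_group l\<^esub> slice \<beta> s u) = vector [s + Im (cnj \<beta> * a), Im b, Im c]"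
  by (auto simp: slice_normal_def slice_def nak_mult vec_eq_iff forall_3 cnj_\<beta> algebra_simps
      simp flip: mult.assoc)

lemma deck_mult_slice:
  assumes "\<gamma> \<in> deck_group"
  shows "\<gamma> \<otimes>\<^bsub>nak_group l\<^esub> slice \<beta> s u = slice \<beta> s (deck \<gamma> u)"
proof -
  obtain a b c where "\<gamma> = (a, b, c)" by (cases \<gamma>)
  then have "slice_normal \<beta> (\<gamma> \<otimes>\<^bsub>nak_group l\<^esub> slice \<beta> s u) = vector [s, 0, 0]"
    using assms by (simp add: slice_normal_mult deck_group_def)
  then show ?thesis
    using slice_of_normal slice_coord_mult by metis
qed

lemma slice_proj_deck: "\<gamma> \<in> deck_group \<Longrightarrow> slice_proj s (deck \<gamma> u) = slice_proj s u"
  using nak_proj_eq_iff[of "slice \<beta> s u" "slice \<beta> s (deck \<gamma> u)"] deck_mult_slice[of \<gamma> s u]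
  unfolding slice_proj_def deck_group_def o_apply by fastforce

text \<open>A lattice element that moves a point of one slice to a point of a nearby slice must preserve the
  slice, because it translates the transversal coordinate by an element of \<open>\<int>\<close> or
  \<open>\<tau>\<int>\<close>.\<close>

lemma slice_proj_eqD:
  assumes "slice_proj s u = slice_proj s' u'" "\<bar>s - s'\<bar> < period"
  shows "s' = s" "\<exists>\<gamma>\<in>deck_group. u' = deck \<gamma> u"
proof -
  obtain \<gamma> where \<gamma>: "\<gamma> \<in> nak_lattice \<tau> P" "slice \<beta> s' u' = \<gamma> \<otimes>\<^bsub>nak_group l\<^esub> slice \<beta> s u"
    using assms(1) nak_proj_eq_iff by (auto simp: slice_proj_def)
  obtain a b c where abc: "\<gamma> = (a, b, c)" by (cases \<gamma>)
  have "vector [s', 0, 0] = (vector [s + Im (cnj \<beta> * a), Im b, Im c] :: real^3)"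
    using \<gamma>(2) slice_normal_mult slice_normal_slice abc by metis
  then have eq: "s' = s + Im (cnj \<beta> * a)" "Im b = 0" "Im c = 0"
    by (auto simp: vector3_eq_iff)
  have "Im (cnj \<beta> * a) = 0"
    using lattice_period(2)[of a b c] \<gamma>(1) abc assms(2) eq(1) by simp
  then show "s' = s" "\<exists>\<gamma>\<in>deck_group. u' = deck \<gamma> u"
    using eq \<gamma> abc slice_coord_slice[of s' u'] slice_coord_mult[of \<gamma> s u]
    by (auto simp: deck_group_def intro!: bexI[of _ \<gamma>])
qed

lemma slice_proj_eq_iff: "slice_proj s u = slice_proj s u' \<longleftrightarrow> (\<exists>\<gamma>\<in>deck_group. u' = deck \<gamma> u)"
  using slice_proj_eqD(2)[of s u s u'] slice_proj_deck[of _ s u] period_pos by auto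

lemma continuous_slice_proj: "continuous_map euclidean (nakamura l \<tau> P) (slice_proj s)"
  unfolding slice_proj_def
proof (rule continuous_map_compose[OF _ continuous_map_nak_proj])
  show "continuous_map euclidean euclidean (slice \<beta> s)"
    unfolding slice_affine[abs_def]
    by (simp add: continuous_on_add linear_continuous_on bounded_linear_slice_tangent)
qed

lemma continuous_slice_proj_leaf:
  "continuous_map euclidean (subtopology (nakamura l \<tau> P) (leaf s)) (slice_proj s)"
  by (auto simp: continuous_map_in_subtopology continuous_slice_proj leaf_def)

lemma continuous_slice_coord: "continuous_on UNIV (slice_coord \<beta>)"
  and continuous_slice_normal: "continuous_on UNIV (slice_normal \<beta>)"
  unfolding slice_coord_def slice_normal_def by (intro continuous_intros)+

text \<open>The translates of a slice that are not the slice itself keep a positive distance from it; this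
  is why leaves are embedded and not only immersed.\<close>

lemma slice_normal_discrete:
  obtains r where "r > 0"
    "\<And>\<gamma> s u. \<gamma> \<in> nak_lattice \<tau> P \<Longrightarrow>
       dist (slice_normal \<beta> (\<gamma> \<otimes>\<^bsub>nak_group l\<^esub> slice \<beta> s u)) (vector [s, 0, 0]) < r \<Longrightarrow> \<gamma> \<in> deck_group"
proof -
  obtain \<epsilon> where \<epsilon>: "\<epsilon> > 0" "\<And>x y. lat x y \<Longrightarrow> \<bar>x\<bar> < \<epsilon> \<Longrightarrow> \<bar>y\<bar> < \<epsilon> \<Longrightarrow> x = 0 \<and> y = 0"
    by (rule lat_discrete) blast
  show ?thesis
  proof (rule that[of "min period \<epsilon>"])
    fix \<gamma> s u
    assume \<gamma>: "\<gamma> \<in> nak_lattice \<tau> P" and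
      d: "dist (slice_normal \<beta> (\<gamma> \<otimes>\<^bsub>nak_group l\<^esub> slice \<beta> s u)) (vector [s, 0, 0]) < min period \<epsilon>"
    obtain a b c where abc: "\<gamma> = (a, b, c)" by (cases \<gamma>)
    have "\<bar>(vector [s + Im (cnj \<beta> * a), Im b, Im c] - vector [s, 0, 0] :: real^3) $ i\<bar> < min period \<epsilon>" for i
      using d component_le_norm_cart[of "vector [s + Im (cnj \<beta> * a), Im b, Im c] - vector [s, 0, 0] :: real^3" i]
      unfolding abc slice_normal_mult dist_norm by linarith
    from this[of 1] this[of 2] this[of 3]
    have "\<bar>Im (cnj \<beta> * a)\<bar> < period" "\<bar>Im b\<bar> < \<epsilon>" "\<bar>Im c\<bar> < \<epsilon>"
      by simp_all
    then show "\<gamma> \<in> deck_group"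
      using \<gamma> lattice_period(2)[of a b c] \<epsilon>(2)[of "Im b" "Im c"]
      by (simp add: deck_group_def abc mem_lattice)
  qed (use period_pos \<epsilon> in auto)
qed

text \<open>An open part of the slice, thickened in the normal directions by less than the distance to the
  other translates of the slice, is open in \<open>G\<close> and meets the preimage of the leaf only in
  translates of that part.\<close>

lemma openin_slice_proj_image:
  assumes "open U"
  shows "openin (subtopology (nakamura l \<tau> P) (leaf s)) (slice_proj s ` U)"
proof -
  obtain r where r: "r > 0"
    "\<And>\<gamma> s u. \<gamma> \<in> nak_lattice \<tau> P \<Longrightarrow>
       dist (slice_normal \<beta> (\<gamma> \<otimes>\<^bsub>nak_group l\<^esub> slice \<beta> s u)) (vector [s, 0, 0]) < r \<Longrightarrow> \<gamma> \<in> deck_group"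
    by (rule slice_normal_discrete) blast
  define W where "W = slice_coord \<beta> -` U \<inter> slice_normal \<beta> -` ball (vector [s, 0, 0]) r"
  have "open W"
    unfolding W_def using assms continuous_slice_coord continuous_slice_normal
    by (intro open_Int open_vimage) auto
  then have "openin (nakamura l \<tau> P) (nak_proj l \<tau> P ` W)"
    by (rule open_map_nak_proj)
  moreover have "slice_proj s ` U = nak_proj l \<tau> P ` W \<inter> leaf s"
  proof (intro equalityI subsetI)
    fix p assume "p \<in> slice_proj s ` U"
    then obtain u where "u \<in> U" "p = nak_proj l \<tau> P (slice \<beta> s u)"
      by (auto simp: slice_proj_def)
    moreover have "slice \<beta> s u \<in> W" if "u \<in> U"
      using that r(1) by (simp add: W_def slice_coord_slice slice_normal_slice)
    ultimately show "p \<in> nak_proj l \<tau> P ` W \<inter> leaf s"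
      by (auto simp: leaf_def slice_proj_def)
  next
    fix p assume "p \<in> nak_proj l \<tau> P ` W \<inter> leaf s"
    then obtain g u where g: "g \<in> W" "p = nak_proj l \<tau> P g" and u: "p = slice_proj s u"
      by (auto simp: leaf_def)
    then have "nak_proj l \<tau> P (slice \<beta> s u) = nak_proj l \<tau> P g"
      by (simp add: slice_proj_def)
    then obtain \<gamma> where \<gamma>: "\<gamma> \<in> nak_lattice \<tau> P" "g = \<gamma> \<otimes>\<^bsub>nak_group l\<^esub> slice \<beta> s u"
      by (auto simp: nak_proj_eq_iff)
    moreover have "dist (slice_normal \<beta> g) (vector [s, 0, 0]) < r"
      using g(1) by (simp add: W_def dist_commute)
    ultimately have "\<gamma> \<in> deck_group"
      using r(2) by blast
    moreover have "deck \<gamma> u \<in> U"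
      using g(1) \<gamma>(2) slice_coord_mult by (auto simp: W_def)
    ultimately show "p \<in> slice_proj s ` U"
      using u slice_proj_deck by (metis imageI)
  qed
  ultimately show ?thesis
    by (auto simp: openin_subtopology)
qed

lemma quotient_map_slice_proj:
  "quotient_map euclidean (subtopology (nakamura l \<tau> P) (leaf s)) (slice_proj s)"
proof (rule continuous_open_imp_quotient_map[OF continuous_slice_proj_leaf])
  show "open_map euclidean (subtopology (nakamura l \<tau> P) (leaf s)) (slice_proj s)"
    by (simp add: open_map_def openin_slice_proj_image)
  show "slice_proj s ` topspace euclidean = topspace (subtopology (nakamura l \<tau> P) (leaf s))"
    using continuous_map_image_subset_topspace[OF continuous_slice_proj]
    by (auto simp: leaf_def)
qed

text \<open>Nontrivial deck transformations move every point by a distance bounded below: either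
  the first coordinate changes by at least the period, or the map is a translation by a nonzero lattice
  vector. The radius depends neither on the leaf nor on the point, so that one ball
  parametrises all members of the family.\<close>

lemma locally_injective_slice_proj:
  obtains \<delta> where "\<delta> > 0" "\<And>s u. inj_on (slice_proj s) (ball u \<delta>)"
proof -
  obtain \<epsilon> where \<epsilon>: "\<epsilon> > 0" "\<And>x y. lat x y \<Longrightarrow> \<bar>x\<bar> < \<epsilon> \<Longrightarrow> \<bar>y\<bar> < \<epsilon> \<Longrightarrow> x = 0 \<and> y = 0"
    by (rule lat_discrete) blast
  define \<delta> where "\<delta> = min period \<epsilon> / 2"
  show ?thesis
  proof (rule that[of \<delta>])
    fix s u
    show "inj_on (slice_proj s) (ball u \<delta>)"
    proof (rule inj_onI)
      fix x y assume xy: "x \<in> ball u \<delta>" "y \<in> ball u \<delta>" "slice_proj s x = slice_proj s y"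
      have "dist x y < \<delta> + \<delta>"
        using xy(1,2) dist_triangle3[of x y u] by simp
      then have "norm (y - x) < min period \<epsilon>"
        by (simp only: \<delta>_def field_sum_of_halves dist_norm norm_minus_commute[of y x])
      then have small: "\<bar>(y - x) $ i\<bar> < period" "\<bar>(y - x) $ i\<bar> < \<epsilon>" for i
        using component_le_norm_cart[of "y - x" i] by linarith+
      obtain a b c where abc: "(a, b, c) \<in> deck_group" "y = deck (a, b, c) x"
        using xy(3) by (auto simp: slice_proj_eq_iff)
      have a: "Re (cnj \<beta> * a) = 0"
        using lattice_period(1)[of a b c] small(1)[of 1] abc by (simp add: deck_group_def deck_def)
      then have "cnj \<beta> * a = 0"
        using abc(1) by (simp add: deck_group_def complex_eq_iff)
      then have "a = 0"
        using \<beta> by auto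
      then have "Re b = 0 \<and> Re c = 0"
        using \<epsilon>(2)[of "Re b" "Re c"] small(2)[of 2] small(2)[of 3] abc
        by (simp add: deck_group_def deck_def mem_lattice)
      then show "x = y"
        using abc(2) \<open>a = 0\<close> by (simp add: deck_def vec_eq_iff forall_3)
    qed
  qed (use period_pos \<epsilon> in \<open>simp add: \<delta>_def\<close>)
qed

lemma local_param_slice:
  assumes "open U" "inj_on (slice_proj s) U"
  shows "local_param l \<tau> P (leaf s) U (slice \<beta> s)"
proof -
  have "inj (slice_tangent \<beta>)"
    using \<beta> by (auto simp: inj_def slice_tangent_def vec_eq_iff forall_3)
  moreover have "homeomorphic_map (top_of_set U)
       (subtopology (nakamura l \<tau> P) (slice_proj s ` U)) (slice_proj s)"
  proof (rule bijective_open_imp_homeomorphic_map)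
    show "continuous_map (top_of_set U) (subtopology (nakamura l \<tau> P) (slice_proj s ` U)) (slice_proj s)"
      using continuous_slice_proj
      by (auto simp: continuous_map_in_subtopology intro: continuous_map_from_subtopology)
    show "open_map (top_of_set U) (subtopology (nakamura l \<tau> P) (slice_proj s ` U)) (slice_proj s)"
      unfolding open_map_def
    proof (intro allI impI)
      fix V assume V: "openin (top_of_set U) V"
      then obtain W where W: "openin (nakamura l \<tau> P) W" "slice_proj s ` V = W \<inter> leaf s"
        using openin_slice_proj_image[OF openin_open_trans[OF _ assms(1)], of V s]
        unfolding openin_subtopology[of "nakamura l \<tau> P"] by blast
      have "slice_proj s ` V \<subseteq> slice_proj s ` U" "slice_proj s ` U \<subseteq> leaf s"
        using openin_imp_subset[OF V] by (auto simp: leaf_def)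
      with W(2) have "slice_proj s ` V = W \<inter> slice_proj s ` U"
        by blast
      then show "openin (subtopology (nakamura l \<tau> P) (slice_proj s ` U)) (slice_proj s ` V)"
        using W(1) unfolding openin_subtopology by blast
    qed
    show "slice_proj s ` topspace (top_of_set U)
        = topspace (subtopology (nakamura l \<tau> P) (slice_proj s ` U))"
      using continuous_map_image_subset_topspace[OF continuous_slice_proj] by auto
  qed (use assms(2) in simp)
  ultimately show ?thesis
    using assms(1) openin_slice_proj_image smooth_slice frechet_derivative_slice
    unfolding local_param_def slice_proj_def by simp
qed

text \<open>The linear part of a deck transformation is \<open>diag(1, e\<^sup>r, e\<^sup>-\<^sup>r)\<close>.\<close>

lemma deck_has_derivative:
  "\<exists>D. (deck \<gamma> has_derivative D) (at u) \<and> det (matrix D) > 0"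
proof -
  obtain a b c where abc: "\<gamma> = (a, b, c)" by (cases \<gamma>)
  define D where "D = (\<lambda>u :: real^3. vector [u $ 1, exp (l * Re a) * u $ 2, exp (- l * Re a) * u $ 3] :: real^3)"
  have "linear D"
    by (rule linearI) (simp_all add: D_def vec_eq_iff forall_3 algebra_simps)
  then have "(D has_derivative D) (at u)"
    by (simp add: bounded_linear_imp_has_derivative linear_conv_bounded_linear)
  moreover have "deck \<gamma> = (\<lambda>u. vector [Re (cnj \<beta> * a), Re b, Re c] + D u)"
    by (simp add: abc deck_def D_def vec_eq_iff forall_3 fun_eq_iff)
  ultimately have "(deck \<gamma> has_derivative D) (at u)"
    by (auto intro!: derivative_eq_intros)
  moreover have "det (matrix D) > 0"
    by (simp add: D_def matrix_def det_3 axis_def)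
  ultimately show ?thesis
    by blast
qed

lemma continuous_deck: "continuous_on UNIV (deck \<gamma>)"
  by (cases \<gamma>) (auto simp: deck_def intro!: continuous_intros)

text \<open>Two parametrisations are restrictions of the same slice, so the transition map is locally a deck
  transformation.\<close>

lemma transition_derivative:
  assumes U: "open U" "inj_on (slice_proj s) U" and v: "slice_proj s v \<in> slice_proj s ` U"
  shows "\<exists>D. ((inv_into U (slice_proj s) \<circ> slice_proj s) has_derivative D) (at v) \<and> det (matrix D) > 0"
proof -
  obtain \<gamma> where \<gamma>: "\<gamma> \<in> deck_group" "deck \<gamma> v \<in> U"
    using v by (auto simp: slice_proj_eq_iff)
  obtain D where D: "(deck \<gamma> has_derivative D) (at v)" "det (matrix D) > 0"
    using deck_has_derivative by blast
  have "open (deck \<gamma> -` U)"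
    using U(1) continuous_deck by (intro open_vimage)
  moreover have "deck \<gamma> x = (inv_into U (slice_proj s) \<circ> slice_proj s) x" if "x \<in> deck \<gamma> -` U" for x
    using inv_into_f_f[OF U(2), of "deck \<gamma> x"] slice_proj_deck[OF \<gamma>(1), of s x] that by simp
  ultimately have "((inv_into U (slice_proj s) \<circ> slice_proj s) has_derivative D) (at v)"
    using has_derivative_transform_within_open[OF D(1)] \<gamma>(2) by (metis vimageI2)
  then show ?thesis
    using D(2) by blast
qed

lemma special_lagrangian_leaf: "special_lagrangian l \<tau> P (leaf s)"
proof -
  obtain \<delta> where \<delta>: "\<delta> > 0" "\<And>s u. inj_on (slice_proj s) (ball u \<delta>)"
    by (rule locally_injective_slice_proj) blast
  define A where "A = range (\<lambda>u :: real^3. (ball u \<delta>, slice \<beta> s))"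
  have "oriented_submanifold l \<tau> P (leaf s) A"
    unfolding oriented_submanifold_def
  proof (intro conjI)
    show "\<forall>(U, f)\<in>A. local_param l \<tau> P (leaf s) U f"
      using local_param_slice \<delta>(2) by (auto simp: A_def)
    show "leaf s = (\<Union>(U, f)\<in>A. (nak_proj l \<tau> P \<circ> f) ` U)"
      using \<delta>(1) by (auto simp: A_def leaf_def slice_proj_def image_iff intro: centre_in_ball[THEN iffD2])
    show "\<forall>(U, f)\<in>A. \<forall>(V, g)\<in>A. \<forall>v\<in>V. nak_proj l \<tau> P (g v) \<in> (nak_proj l \<tau> P \<circ> f) ` U \<longrightarrow>
        (\<exists>D. ((inv_into U (nak_proj l \<tau> P \<circ> f) \<circ> (nak_proj l \<tau> P \<circ> g)) has_derivative D) (at v) \<and>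
             det (matrix D) > 0)"
      using transition_derivative[OF open_ball \<delta>(2)] by (auto simp: A_def slice_proj_def)
  qed
  moreover have "\<forall>(U, f)\<in>A. \<forall>u\<in>U. \<forall>a b c. let D = frechet_derivative f (at u) in
          nak_omega l (f u) (D a) (D b) = 0 \<and>
          Im (cis (- Arg \<beta>) * nak_Omega l (f u) (D a) (D b) (D c)) = 0"
    using slice_Omega[OF \<beta>] by (auto simp: A_def frechet_derivative_slice slice_omega)
  ultimately show ?thesis
    unfolding special_lagrangian_def by blast
qed

text \<open>Bring the first coordinate into a bounded interval by a translation in the direction \<open>\<beta>\<close>;
  the other two coordinates, possibly rescaled by it, are then reduced modulo \<open>P\<int>\<^sup>2\<close>.\<close>

lemma deck_group_cocompact:
  obtains B where "\<And>u. \<exists>\<gamma>\<in>deck_group. deck \<gamma> u \<in> cball 0 B"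
proof -
  obtain R where R: "\<And>x y. \<exists>a b. lat a b \<and> \<bar>x + a\<bar> \<le> R \<and> \<bar>y + b\<bar> \<le> R"
    by (rule lat_cocompact) blast
  show ?thesis
  proof (rule that[of "(1 + \<bar>\<tau>\<bar>) + R + R"])
    fix u :: "real^3"
    obtain a where a: "Re a \<in> \<int>" "\<exists>n :: int. Im a = \<tau> * of_int n" "Im (cnj \<beta> * a) = 0"
      "\<bar>u $ 1 + Re (cnj \<beta> * a)\<bar> \<le> 1 + \<bar>\<tau>\<bar>"
    proof (cases "\<beta> = 1")
      case True
      show ?thesis
        by (rule that[of "- of_int \<lfloor>u $ 1\<rfloor>"])
           (use True in \<open>simp_all add: exI[of _ 0], linarith\<close>)
    next
      case False
      define n where "n = \<lfloor>u $ 1 / \<tau>\<rfloor>"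
      have "\<bar>u $ 1 / \<tau> - of_int n\<bar> \<le> 1"
        unfolding n_def by linarith
      then have "\<bar>\<tau>\<bar> * \<bar>u $ 1 / \<tau> - of_int n\<bar> \<le> \<bar>\<tau>\<bar> * 1"
        by (intro mult_left_mono) auto
      then have "\<bar>u $ 1 - \<tau> * of_int n\<bar> \<le> \<bar>\<tau>\<bar>"
        unfolding abs_mult[symmetric] using tau_nonzero by (simp add: algebra_simps)
      then show ?thesis
        using False \<beta>
        by (intro that[of "Complex 0 (\<tau> * of_int (- n))"]) (auto intro: exI[of _ "- n"])
    qed
    obtain b c where bc: "lat b c" "\<bar>exp (l * Re a) * u $ 2 + b\<bar> \<le> R" "\<bar>exp (- l * Re a) * u $ 3 + c\<bar> \<le> R"
      using R by blast
    define \<gamma> :: C3 where "\<gamma> = (a, of_real b, of_real c)"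
    have "\<gamma> \<in> deck_group"
      using a bc(1) lat_zero by (simp add: \<gamma>_def deck_group_def mem_lattice)
    moreover have "norm (deck \<gamma> u) \<le> (1 + \<bar>\<tau>\<bar>) + R + R"
      using norm_le_l1_cart[of "deck \<gamma> u"] a(4) bc(2,3) by (simp add: sum_3 deck_def \<gamma>_def)
    ultimately show "\<exists>\<gamma>\<in>deck_group. deck \<gamma> u \<in> cball 0 ((1 + \<bar>\<tau>\<bar>) + R + R)"
      by auto
  qed
qed

lemma compactin_leaf: "compactin (nakamura l \<tau> P) (leaf s)"
proof -
  obtain B where B: "\<And>u. \<exists>\<gamma>\<in>deck_group. deck \<gamma> u \<in> cball 0 B"
    by (rule deck_group_cocompact) blast
  have "leaf s = slice_proj s ` cball 0 B"
    unfolding leaf_def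
  proof (intro equalityI subsetI)
    fix p assume "p \<in> range (slice_proj s)"
    then obtain u where u: "p = slice_proj s u" by blast
    obtain \<gamma> where "\<gamma> \<in> deck_group" "deck \<gamma> u \<in> cball 0 B"
      using B by blast
    then show "p \<in> slice_proj s ` cball 0 B"
      using u slice_proj_deck by blast
  qed auto
  moreover have "compactin euclidean (cball 0 B :: (real^3) set)"
    by simp
  ultimately show ?thesis
    using image_compactin continuous_slice_proj by metis
qed

lemma connectedin_leaf: "connectedin (nakamura l \<tau> P) (leaf s)"
  unfolding leaf_def
  by (rule connectedin_continuous_map_image[OF continuous_slice_proj])
     (simp add: convex_connected)

lemma special_lagrangian_family_leaf: "special_lagrangian_family l \<tau> P {0<..<period} leaf"
  unfolding special_lagrangian_family_def
proof (intro conjI ballI)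
  show "inj_on leaf {0<..<period}"
  proof (rule inj_onI)
    fix s t assume st: "s \<in> {0<..<period}" "t \<in> {0<..<period}" "leaf s = leaf t"
    then obtain u where "slice_proj s 0 = slice_proj t u"
      unfolding leaf_def by (metis rangeE rangeI)
    then show "s = t"
      using slice_proj_eqD(1)[of s 0 t u] st(1,2) by (simp add: abs_less_iff)
  qed
next
  fix t p assume t: "t \<in> {0<..<period}" and p: "p \<in> leaf t"
  obtain \<delta> where \<delta>: "\<delta> > 0" "\<And>s u. inj_on (slice_proj s) (ball u \<delta>)"
    by (rule locally_injective_slice_proj) blast
  obtain u where u: "p = slice_proj t u"
    using p by (auto simp: leaf_def)
  show "\<exists>J U F. open J \<and> t \<in> J \<and> J \<subseteq> {0<..<period} \<and> smooth_on (J \<times> U) F \<and>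
        (\<forall>s\<in>J. local_param l \<tau> P (leaf s) U (\<lambda>u. F (s, u))) \<and>
        p \<in> (\<lambda>u. nak_proj l \<tau> P (F (t, u))) ` U"
    using t u \<delta> smooth_slice_family local_param_slice
    by (intro exI[of _ "{0<..<period}"] exI[of _ "ball u \<delta>"] exI[of _ "\<lambda>(s, u). slice \<beta> s u"])
       (auto simp: slice_proj_def)
qed (use period_pos special_lagrangian_leaf compactin_leaf connectedin_leaf in \<open>auto simp: leaf_def\<close>)

end

section \<open>Telling the two kinds of leaves apart\<close>

lemma exp_eq_1_const:
  fixes d :: "real^3 \<Rightarrow> complex"
  assumes "continuous_on UNIV d" and "\<And>u. exp (d u) = 1"
  obtains k :: int where "\<And>u. d u = 2 * pi * \<i> * of_int k"
proof -
  have ex: "\<exists>k :: int. d u = 2 * pi * \<i> * of_int k" for u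
    using assms(2)[of u] unfolding exp_eq_1 by (auto simp: complex_eq_iff)
  have "d constant_on UNIV"
  proof (rule continuous_discrete_range_constant)
    fix u
    show "\<exists>e>0. \<forall>v. v \<in> UNIV \<and> d v \<noteq> d u \<longrightarrow> e \<le> norm (d v - d u)"
    proof (intro exI conjI allI impI)
      fix v assume v: "v \<in> UNIV \<and> d v \<noteq> d u"
      obtain m n :: int where mn: "d v = 2 * pi * \<i> * of_int m" "d u = 2 * pi * \<i> * of_int n"
        using ex by metis
      then have "m \<noteq> n"
        using v by auto
      then have "1 \<le> \<bar>real_of_int (m - n)\<bar>"
        by linarith
      moreover have "norm (d v - d u) = 2 * pi * \<bar>real_of_int (m - n)\<bar>"
        unfolding mn right_diff_distrib[symmetric] norm_mult of_int_diff[symmetric] norm_of_int by simp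
      ultimately show "1 \<le> norm (d v - d u)"
        using pi_ge_two by (smt (verit) mult_le_cancel_left1 mult_left_mono)
    qed simp
  qed (use assms in auto)
  then show ?thesis
    using ex that unfolding constant_on_def by (metis UNIV_I)
qed

text \<open>The group of homotopy classes of maps from \<open>X\<close> to \<open>\<complex> - {0}\<close> has rank at most one, where
  being homotopic to a constant is expressed as having a continuous logarithm.\<close>

definition log_dependent :: "'a topology \<Rightarrow> bool" where
  "log_dependent X \<longleftrightarrow>
     (\<forall>f1 f2. continuous_map X euclidean f1 \<and> continuous_map X euclidean f2 \<and>
        (\<forall>x\<in>topspace X. f1 x \<noteq> 0 \<and> f2 x \<noteq> 0) \<longrightarrow>
        (\<exists>m n h. (m \<noteq> 0 \<or> n \<noteq> 0) \<and> continuous_map X euclidean h \<and>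
           (\<forall>x\<in>topspace X. (f1 x :: complex) powi m * f2 x powi n = exp (h x))))"

lemma log_dependentE:
  fixes f1 f2 :: "'a \<Rightarrow> complex"
  assumes "log_dependent X" "continuous_map X euclidean f1" "continuous_map X euclidean f2"
    "\<And>x. x \<in> topspace X \<Longrightarrow> f1 x \<noteq> 0 \<and> f2 x \<noteq> 0"
  obtains m n h where "m \<noteq> 0 \<or> n \<noteq> 0" "continuous_map X euclidean h"
    "\<And>x. x \<in> topspace X \<Longrightarrow> f1 x powi m * f2 x powi n = exp (h x)"
proof -
  have "\<exists>m n h. (m \<noteq> 0 \<or> n \<noteq> 0) \<and> continuous_map X euclidean h \<and>
           (\<forall>x\<in>topspace X. f1 x powi m * f2 x powi n = exp (h x))"
    using assms(2-)
    by (intro assms(1)[unfolded log_dependent_def, THEN spec, THEN spec, THEN mp] conjI ballI) auto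
  then show ?thesis
    using that by metis
qed

lemma log_dependent_homeomorphic:
  assumes "X homeomorphic_space Y" "log_dependent Y"
  shows "log_dependent X"
  unfolding log_dependent_def
proof (intro allI impI, elim conjE)
  fix f1 f2 :: "'a \<Rightarrow> complex"
  assume f: "continuous_map X euclidean f1" "continuous_map X euclidean f2"
    "\<forall>x\<in>topspace X. f1 x \<noteq> 0 \<and> f2 x \<noteq> 0"
  obtain \<phi> \<psi> where \<phi>: "continuous_map X Y \<phi>" and \<psi>: "continuous_map Y X \<psi>"
    and inv: "\<And>x. x \<in> topspace X \<Longrightarrow> \<psi> (\<phi> x) = x"
    using assms(1) unfolding homeomorphic_space_def homeomorphic_maps_def by blast
  have in_X: "\<psi> y \<in> topspace X" if "y \<in> topspace Y" for y
    using continuous_map_image_subset_topspace[OF \<psi>] that by blast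
  have in_Y: "\<phi> x \<in> topspace Y" if "x \<in> topspace X" for x
    using continuous_map_image_subset_topspace[OF \<phi>] that by blast
  obtain m n h where mn: "m \<noteq> 0 \<or> n \<noteq> 0" and h: "continuous_map Y euclidean h"
    "\<And>y. y \<in> topspace Y \<Longrightarrow> (f1 \<circ> \<psi>) y powi m * (f2 \<circ> \<psi>) y powi n = exp (h y)"
  proof (rule log_dependentE[OF assms(2)])
    show "continuous_map Y euclidean (f1 \<circ> \<psi>)" "continuous_map Y euclidean (f2 \<circ> \<psi>)"
      using \<psi> f(1,2) by (auto intro: continuous_map_compose)
    show "(f1 \<circ> \<psi>) y \<noteq> 0 \<and> (f2 \<circ> \<psi>) y \<noteq> 0" if "y \<in> topspace Y" for y
      using f(3) in_X[OF that] by simp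
  qed blast
  have "continuous_map X euclidean (h \<circ> \<phi>)"
    using \<phi> h(1) by (rule continuous_map_compose)
  moreover have "f1 x powi m * f2 x powi n = exp ((h \<circ> \<phi>) x)" if "x \<in> topspace X" for x
    using h(2)[OF in_Y[OF that]] inv[OF that] by simp
  ultimately show "\<exists>m n h. (m \<noteq> 0 \<or> n \<noteq> 0) \<and> continuous_map X euclidean h \<and>
           (\<forall>x\<in>topspace X. f1 x powi m * f2 x powi n = exp (h x))"
    using mn by blast
qed

context nakamura_slice
begin

lemma topspace_leaf: "topspace (subtopology (nakamura l \<tau> P) (leaf s)) = leaf s"
  using continuous_map_image_subset_topspace[OF continuous_slice_proj] by (auto simp: leaf_def)

lemma descend_to_leaf:
  fixes g :: "real^3 \<Rightarrow> complex"
  assumes "continuous_on UNIV g" and "\<And>\<gamma> u. \<gamma> \<in> deck_group \<Longrightarrow> g (deck \<gamma> u) = g u"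
  obtains h where "continuous_map (subtopology (nakamura l \<tau> P) (leaf s)) euclidean h"
    "\<And>u. h (slice_proj s u) = g u"
proof -
  have "continuous_map euclidean euclidean g"
    using assms(1) by simp
  moreover have "g u = g v" if "slice_proj s u = slice_proj s v" for u v
    using that assms(2) by (auto simp: slice_proj_eq_iff)
  ultimately obtain h where "continuous_map (subtopology (nakamura l \<tau> P) (leaf s)) euclidean h"
    "\<forall>u\<in>topspace euclidean. h (slice_proj s u) = g u"
    using quotient_map_lift_exists[OF quotient_map_slice_proj] by (metis UNIV_I topspace_euclidean)
  then show ?thesis
    using that by simp
qed

end

lemma (in nakamura_data) nakamura_slice_1: "nakamura_slice l \<tau> M P 1"
  and nakamura_slice_ii: "nakamura_slice l \<tau> M P \<i>"
  by unfold_locales auto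

text \<open>The angular coordinates \<open>u\<^sub>1 / \<tau>\<close> and \<open>\<kappa>(u\<^sub>2, u\<^sub>3)\<close> are independent: a logarithm of
  the product of their powers would lift, up to a constant, to the corresponding linear combination on
  \<open>\<real>\<^sup>3\<close>, which is not invariant under translations unless both exponents are zero.\<close>

lemma (in nakamura_data) torus_not_log_dependent:
  "\<not> log_dependent (subtopology (nakamura l \<tau> P) (nakamura_slice.leaf l \<tau> P \<i> s))"
proof
  interpret nakamura_slice l \<tau> M P \<i>
    by (rule nakamura_slice_ii)
  assume dep: "log_dependent (subtopology (nakamura l \<tau> P) (leaf s))"
  obtain \<kappa> :: "real \<Rightarrow> real \<Rightarrow> real" and b c where
    \<kappa>: "continuous_on UNIV (\<lambda>u :: real^3. \<kappa> (u $ 2) (u $ 3))"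
    "\<And>x y x' y'. \<kappa> (x + x') (y + y') = \<kappa> x y + \<kappa> x' y'"
    "\<And>x y. lat x y \<Longrightarrow> \<kappa> x y \<in> \<int>" "lat b c" "\<kappa> b c = 1"
    by (rule lat_dual) blast
  have deck: "\<exists>n :: int. deck (a, b, c) u = vector [u $ 1 + \<tau> * of_int n, u $ 2 + Re b, u $ 3 + Re c]"
    if "(a, b, c) \<in> deck_group" for a b c u
    using that by (auto simp: deck_def deck_group_def mem_lattice vector3_eq_iff)
  define g1 where "g1 = (\<lambda>u :: real^3. 2 * pi * \<i> * of_real (u $ 1 / \<tau>))"
  define g2 where "g2 = (\<lambda>u :: real^3. 2 * pi * \<i> * of_real (\<kappa> (u $ 2) (u $ 3)))"
  have cont: "continuous_on UNIV g1" "continuous_on UNIV g2"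
    unfolding g1_def g2_def using \<kappa>(1) tau_nonzero by (auto intro!: continuous_intros)
  have exp_int: "exp (2 * pi * \<i> * of_real (x + k)) = exp (2 * pi * \<i> * of_real x)" if "k \<in> \<int>" for x k
    using that by (auto simp: exp_eq algebra_simps elim!: Ints_cases)
  have "exp (g1 (deck \<gamma> u)) = exp (g1 u) \<and> exp (g2 (deck \<gamma> u)) = exp (g2 u)"
    if \<gamma>: "\<gamma> \<in> deck_group" for \<gamma> u
  proof -
    obtain a b c where abc: "\<gamma> = (a, b, c)" by (cases \<gamma>)
    obtain n :: int where n: "deck \<gamma> u = vector [u $ 1 + \<tau> * of_int n, u $ 2 + Re b, u $ 3 + Re c]"
      using deck \<gamma> unfolding abc by blast
    have "\<kappa> (Re b) (Re c) \<in> \<int>"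
      using \<gamma> \<kappa>(3) by (auto simp: abc deck_group_def mem_lattice)
    moreover have "(u $ 1 + \<tau> * of_int n) / \<tau> = u $ 1 / \<tau> + of_int n"
      using tau_nonzero by (simp add: field_simps)
    ultimately show ?thesis
      unfolding g1_def g2_def n vector_3 \<kappa>(2) by (metis exp_int Ints_of_int)
  qed
  note inv = this
  obtain f1 where f1: "continuous_map (subtopology (nakamura l \<tau> P) (leaf s)) euclidean f1"
    "\<And>u. f1 (slice_proj s u) = exp (g1 u)"
    using descend_to_leaf[of "\<lambda>u. exp (g1 u)" s] cont inv by (auto intro: continuous_on_exp)
  obtain f2 where f2: "continuous_map (subtopology (nakamura l \<tau> P) (leaf s)) euclidean f2"
    "\<And>u. f2 (slice_proj s u) = exp (g2 u)"
    using descend_to_leaf[of "\<lambda>u. exp (g2 u)" s] cont inv by (auto intro: continuous_on_exp)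
  obtain m n h where mn: "m \<noteq> 0 \<or> n \<noteq> 0" and
    h: "continuous_map (subtopology (nakamura l \<tau> P) (leaf s)) euclidean h"
       "\<And>p. p \<in> leaf s \<Longrightarrow> f1 p powi m * f2 p powi n = exp (h p)"
  proof (rule log_dependentE[OF dep f1(1) f2(1), unfolded topspace_leaf])
    show "f1 p \<noteq> 0 \<and> f2 p \<noteq> 0" if "p \<in> leaf s" for p
      using that by (auto simp: leaf_def f1(2) f2(2))
  qed blast
  define d where "d = (\<lambda>u. of_int m * g1 u + of_int n * g2 u - h (slice_proj s u))"
  have "continuous_on UNIV (\<lambda>u. h (slice_proj s u))"
    using continuous_map_compose[OF continuous_slice_proj_leaf h(1)] by (simp add: o_def)
  then have "continuous_on UNIV d"
    unfolding d_def using cont by (intro continuous_intros)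
  moreover have "exp (d u) = 1" for u
  proof -
    have "exp (of_int m * g1 u + of_int n * g2 u) = exp (h (slice_proj s u))"
      using h(2)[of "slice_proj s u"] by (simp add: leaf_def f1(2) f2(2) exp_add exp_power_int)
    then show ?thesis
      by (simp add: d_def exp_diff)
  qed
  ultimately obtain k :: int where k: "\<And>u. d u = 2 * pi * \<i> * of_int k"
    by (rule exp_eq_1_const) blast
  have per: "of_int m * g1 (deck \<gamma> 0) + of_int n * g2 (deck \<gamma> 0) = of_int m * g1 0 + of_int n * g2 0"
    if "\<gamma> \<in> deck_group" for \<gamma>
    using trans[OF k[of "deck \<gamma> 0"] k[of 0, symmetric]] slice_proj_deck[OF that, of s 0]
    by (simp add: d_def)
  have \<kappa>0: "\<kappa> 0 0 = 0"
    using \<kappa>(2)[of 0 0 0 0] by simp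
  have "(\<i> * of_real \<tau>, 0, 0) \<in> deck_group" "(0, of_real b, of_real c) \<in> deck_group"
    using lat_zero \<kappa>(4) by (auto simp: deck_group_def mem_lattice intro!: exI[of _ 1] exI[of _ 0])
  from per[OF this(1)] per[OF this(2)] have "m = 0" "n = 0"
    using tau_nonzero by (simp_all add: g1_def g2_def deck_def \<kappa>0 \<kappa>(5))
  then show False
    using mn by simp
qed

text \<open>Up to a factor with a logarithm, every map from the mapping torus to \<open>\<complex> - {0}\<close> is a power
  of the map to the base circle.\<close>

lemma (in nakamura_data) mapping_torus_log:
  fixes s :: real and f :: "C3 set \<Rightarrow> complex"
  defines "X \<equiv> subtopology (nakamura l \<tau> P) (nakamura_slice.leaf l \<tau> P 1 s)"
  assumes "continuous_map X euclidean f" and "\<And>p. p \<in> topspace X \<Longrightarrow> f p \<noteq> 0"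
  obtains k :: int and h where "continuous_map X euclidean h"
    "\<And>u. f (nakamura_slice.slice_proj l \<tau> P 1 s u)
       = exp (2 * pi * \<i> * of_int k * of_real (u $ 1) + h (nakamura_slice.slice_proj l \<tau> P 1 s u))"
proof -
  interpret nakamura_slice l \<tau> M P 1
    by (rule nakamura_slice_1)
  have "continuous_on UNIV (f \<circ> slice_proj s)"
    using continuous_map_compose[OF continuous_slice_proj_leaf assms(2)[unfolded X_def]]
    by (simp only: continuous_map_iff_continuous2)
  moreover have "contractible (UNIV :: (real^3) set)"
    by (simp add: convex_imp_contractible)
  moreover have "(f \<circ> slice_proj s) u \<noteq> 0" for u
    using assms(3)[of "slice_proj s u"] unfolding X_def topspace_leaf by (simp add: leaf_def)
  ultimately obtain g where g: "continuous_on UNIV g" "\<And>u. f (slice_proj s u) = exp (g u)"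
    using continuous_logarithm_on_contractible[of UNIV "f \<circ> slice_proj s"]
    by (metis UNIV_I o_apply)
  have "\<exists>k :: int. \<forall>u. g (deck \<gamma> u) - g u = 2 * pi * \<i> * of_int k" if "\<gamma> \<in> deck_group" for \<gamma>
  proof -
    have "continuous_on UNIV (\<lambda>u. g (deck \<gamma> u) - g u)"
      using continuous_on_compose2[OF g(1) continuous_deck] g(1) by (intro continuous_intros) auto
    moreover have "exp (g (deck \<gamma> u) - g u) = 1" for u
      using slice_proj_deck[OF that, of s u] g(2) by (metis exp_diff exp_not_eq_zero right_inverse_eq)
    ultimately show ?thesis
      using exp_eq_1_const[of "\<lambda>u. g (deck \<gamma> u) - g u"] by metis
  qed
  then obtain \<nu> :: "C3 \<Rightarrow> int" where
    \<nu>: "\<And>\<gamma> u. \<gamma> \<in> deck_group \<Longrightarrow> g (deck \<gamma> u) = g u + 2 * pi * \<i> * of_int (\<nu> \<gamma>)"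
    by (metis add_diff_cancel_left' add.commute diff_add_cancel)
  \<comment> \<open>The deck group is generated by the translations \<open>tr\<close> along the fibre and by \<open>sh\<close>, which goes
  once around the base.\<close>
  define tr :: "real \<Rightarrow> real \<Rightarrow> C3" where "tr = (\<lambda>b c. (0, of_real b, of_real c))"
  define sh :: C3 where "sh = (1, 0, 0)"
  have tr: "tr b c \<in> deck_group" if "lat b c" for b c
    using that lat_zero by (auto simp: tr_def deck_group_def mem_lattice intro!: exI[of _ 0])
  have sh: "sh \<in> deck_group"
    using lat_zero by (auto simp: sh_def deck_group_def mem_lattice intro!: exI[of _ 0])
  have deck_tr: "deck (tr b c) u = vector [u $ 1, u $ 2 + b, u $ 3 + c]" for b c u
    by (simp add: tr_def deck_def)
  have deck_sh: "deck sh u = vector [u $ 1 + 1, exp l * u $ 2, exp (- l) * u $ 3]" for u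
    by (simp add: sh_def deck_def)
  have cancel: "j = k" if "z + 2 * pi * \<i> * of_int j = z + 2 * pi * \<i> * of_int k" for j k :: int and z
    using that by simp
  have add: "\<nu> (tr (b + b') (c + c')) = \<nu> (tr b c) + \<nu> (tr b' c')" if "lat b c" "lat b' c'" for b c b' c'
  proof (rule cancel)
    have "deck (tr (b + b') (c + c')) 0 = deck (tr b c) (deck (tr b' c') 0)"
      by (simp add: deck_tr add.commute)
    then show "g 0 + 2 * pi * \<i> * of_int (\<nu> (tr (b + b') (c + c')))
      = g 0 + 2 * pi * \<i> * of_int (\<nu> (tr b c) + \<nu> (tr b' c'))"
      using \<nu>[OF tr[OF lat_add[OF that]], of 0] \<nu>[OF tr[OF that(1)], of "deck (tr b' c') 0"]
        \<nu>[OF tr[OF that(2)], of 0] by (simp add: algebra_simps)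
  qed
  \<comment> \<open>Conjugating a translation by \<open>sh\<close> applies \<open>D\<close> to the translation vector.\<close>
  have conj: "\<nu> (tr (exp l * b) (exp (- l) * c)) = \<nu> (tr b c)" if "lat b c" for b c
  proof (rule cancel)
    have "deck sh (deck (tr b c) 0) = deck (tr (exp l * b) (exp (- l) * c)) (deck sh 0)"
      by (simp add: deck_tr deck_sh)
    then show "(g 0 + 2 * pi * \<i> * of_int (\<nu> sh)) + 2 * pi * \<i> * of_int (\<nu> (tr (exp l * b) (exp (- l) * c)))
      = (g 0 + 2 * pi * \<i> * of_int (\<nu> sh)) + 2 * pi * \<i> * of_int (\<nu> (tr b c))"
      using \<nu>[OF tr[OF lat_exp[OF that]], of "deck sh 0"] \<nu>[OF tr[OF that], of 0]
        \<nu>[OF sh, of 0] \<nu>[OF sh, of "deck (tr b c) 0"] by (simp add: algebra_simps)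
  qed
  have zero: "\<nu> (tr b c) = 0" if bc: "lat b c" for b c
  proof -
    obtain k :: int where k: "exp l + exp (- l) = of_int k"
      by (rule exp_trace_int)
    \<comment> \<open>This is where the hyperbolicity of \<open>M\<close> enters: the trace is greater than \<open>2\<close>.\<close>
    have "(exp (l / 2) - exp (- l / 2))\<^sup>2 > 0"
      using l_nonzero by simp
    moreover have "(exp (l / 2) - exp (- l / 2))\<^sup>2 = exp l + exp (- l) - 2"
      by (simp add: power2_diff flip: exp_double exp_add)
    ultimately have "k > 2"
      using k by linarith
    have "\<nu> (tr (of_nat j * b) (of_nat j * c)) = of_nat j * \<nu> (tr b c)" for j
    proof (induction j)
      case 0
      then show ?case
        using add[of 0 0 0 0] lat_zero by simp
    next
      case (Suc j)
      then show ?case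
        using add[OF bc lat_of_nat_mult[OF bc, of j]] by (simp add: algebra_simps)
    qed
    from this[of "nat k"] have "\<nu> (tr (of_int k * b) (of_int k * c)) = k * \<nu> (tr b c)"
      using \<open>k > 2\<close> by simp
    moreover have "of_int k * b = exp l * b + exp (- l) * b" "of_int k * c = exp (- l) * c + exp l * c"
      by (simp_all add: k[symmetric] algebra_simps)
    moreover have "\<nu> (tr (exp (- l) * b) (exp l * c)) = \<nu> (tr b c)"
      using conj[OF lat_exp_minus[OF bc]] by (simp flip: exp_add mult.assoc)
    ultimately have "k * \<nu> (tr b c) = 2 * \<nu> (tr b c)"
      using add[OF lat_exp[OF bc] lat_exp_minus[OF bc]] conj[OF bc] by simp
    then show ?thesis
      using \<open>k > 2\<close> by simp
  qed
  \<comment> \<open>Subtracting the contribution of the base makes the logarithm invariant under all deck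
  transformations, so it descends to the leaf.\<close>
  define g' where "g' = (\<lambda>u. g u - 2 * pi * \<i> * of_int (\<nu> sh) * of_real (u $ 1))"
  define sh_pow :: "int \<Rightarrow> real^3 \<Rightarrow> real^3" where
    "sh_pow = (\<lambda>n u.
       vector [u $ 1 + of_int n, exp (l * of_int n) * u $ 2, exp (- l * of_int n) * u $ 3])"
  have g'_sh: "g' (sh_pow (i + 1) u) = g' (sh_pow i u)" for i u
  proof -
    have "sh_pow (i + 1) u = deck sh (sh_pow i u)"
      by (simp add: deck_sh sh_pow_def vector3_eq_iff distrib_left exp_add exp_diff exp_minus field_simps)
    then show ?thesis
      using \<nu>[OF sh, of "sh_pow i u"] by (simp add: g'_def deck_sh algebra_simps)
  qed
  have inv_sh: "g' (sh_pow n u) = g' u" for u n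
  proof (induction n rule: int_induct[where k = 0])
    case base
    have "sh_pow 0 u = u"
      by (simp add: sh_pow_def vec_eq_iff forall_3)
    then show ?case
      by simp
  next
    case (step1 i)
    then show ?case
      by (simp add: g'_sh)
  next
    case (step2 i)
    then show ?case
      using g'_sh[of "i - 1" u] by simp
  qed
  have "g' (deck \<gamma> u) = g' u" if \<gamma>: "\<gamma> \<in> deck_group" for \<gamma> u
  proof -
    obtain a b c where abc: "\<gamma> = (a, b, c)" by (cases \<gamma>)
    obtain n :: int where n: "Re a = of_int n" and lat: "lat (Re b) (Re c)"
      using \<gamma> by (auto simp: abc deck_group_def mem_lattice elim!: Ints_cases)
    have "deck \<gamma> u = deck (tr (Re b) (Re c)) (sh_pow n u)"
      by (simp add: deck_tr sh_pow_def) (simp add: abc deck_def n)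
    moreover have "g' (deck (tr (Re b) (Re c)) (sh_pow n u)) = g' (sh_pow n u)"
      using \<nu>[OF tr[OF lat], of "sh_pow n u"] zero[OF lat] by (simp add: g'_def deck_tr)
    ultimately show ?thesis
      using inv_sh[of n u] by simp
  qed
  moreover have "continuous_on UNIV g'"
    unfolding g'_def using g(1) by (intro continuous_intros)
  ultimately obtain h where "continuous_map X euclidean h" "\<And>u. h (slice_proj s u) = g' u"
    unfolding X_def using descend_to_leaf[of g' s] by blast
  then show ?thesis
    using that[of h "\<nu> sh"] g(2) by (simp add: g'_def)
qed

text \<open>Choosing exponents such that the powers of the map to the base circle cancel leaves a map with a
  logarithm.\<close>

lemma (in nakamura_data) mapping_torus_log_dependent:
  "log_dependent (subtopology (nakamura l \<tau> P) (nakamura_slice.leaf l \<tau> P 1 s))"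
  unfolding log_dependent_def
proof (intro allI impI, elim conjE)
  interpret nakamura_slice l \<tau> M P 1
    by (rule nakamura_slice_1)
  let ?X = "subtopology (nakamura l \<tau> P) (leaf s)"
  fix f1 f2 :: "C3 set \<Rightarrow> complex"
  assume f: "continuous_map ?X euclidean f1" "continuous_map ?X euclidean f2"
    "\<forall>p\<in>topspace ?X. f1 p \<noteq> 0 \<and> f2 p \<noteq> 0"
  obtain k1 h1 where 1: "continuous_map ?X euclidean h1"
    "\<And>u. f1 (slice_proj s u) = exp (2 * pi * \<i> * of_int k1 * of_real (u $ 1) + h1 (slice_proj s u))"
    by (rule mapping_torus_log[OF f(1)]) (use f(3) in auto)
  obtain k2 h2 where 2: "continuous_map ?X euclidean h2"
    "\<And>u. f2 (slice_proj s u) = exp (2 * pi * \<i> * of_int k2 * of_real (u $ 1) + h2 (slice_proj s u))"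
    by (rule mapping_torus_log[OF f(2)]) (use f(3) in auto)
  obtain m n where mn: "m \<noteq> 0 \<or> n \<noteq> 0" "m * k1 + n * k2 = 0"
  proof (cases "k1 = 0")
    case True
    show ?thesis
      by (rule that[of 1 0]) (use True in auto)
  next
    case False
    show ?thesis
      by (rule that[of k2 "- k1"]) (use False in auto)
  qed
  define h where "h = (\<lambda>p. of_int m * h1 p + of_int n * h2 p)"
  have "continuous_map ?X euclidean (\<lambda>p. c * f p)" if "continuous_map ?X euclidean f"
    for f and c :: complex
  proof -
    have "continuous_map euclidean euclidean ((*) c)"
      using continuous_on_mult_left[OF continuous_on_id, of UNIV c] by simp
    from continuous_map_compose[OF that this] show ?thesis
      by (simp only: o_def)
  qed
  then have "continuous_map ?X euclidean h"
    unfolding h_def using 1(1) 2(1) by (intro continuous_map_add)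
  moreover have "f1 p powi m * f2 p powi n = exp (h p)" if p: "p \<in> topspace ?X" for p
  proof -
    obtain u where u: "p = slice_proj s u"
      using p by (auto simp: topspace_leaf leaf_def)
    define z where "z = 2 * pi * \<i> * of_real (u $ 1)"
    have "f1 p powi m * f2 p powi n = exp (of_int m * (z * of_int k1 + h1 p) + of_int n * (z * of_int k2 + h2 p))"
      unfolding u 1(2) 2(2) exp_power_int exp_add[symmetric] by (simp add: z_def mult_ac)
    also have "of_int m * (z * of_int k1 + h1 p) + of_int n * (z * of_int k2 + h2 p)
        = z * of_int (m * k1 + n * k2) + h p"
      by (simp add: h_def algebra_simps)
    finally show ?thesis
      by (simp add: mn)
  qed
  ultimately show "\<exists>m n h. (m \<noteq> 0 \<or> n \<noteq> 0) \<and> continuous_map ?X euclidean h \<and>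
           (\<forall>p\<in>topspace ?X. f1 p powi m * f2 p powi n = exp (h p))"
    using mn(1) by blast
qed

theorem corollary5p1:
  fixes l \<tau> :: real and M :: "int^2^2" and P :: "real^2^2"
  assumes "l \<noteq> 0" and "\<tau> \<noteq> 0"
    and "det M = 1" and "invertible P"
    and "P ** (\<chi> i j. of_int (M $ i $ j)) ** matrix_inv P
           = vector [vector [exp l, 0], vector [0, exp (- l)]]"
  shows "\<exists>T1 L1 T2 L2.
           special_lagrangian_family l \<tau> P T1 L1 \<and>
           special_lagrangian_family l \<tau> P T2 L2 \<and>
           (\<forall>s\<in>T1. \<forall>t\<in>T2.
              \<not> subtopology (nakamura l \<tau> P) (L1 s) homeomorphic_space
                 subtopology (nakamura l \<tau> P) (L2 t))"
proof -
  interpret nakamura_data l \<tau> M P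
    using assms by unfold_locales auto
  interpret torus: nakamura_slice l \<tau> M P \<i>
    by (rule nakamura_slice_ii)
  interpret mapping_torus: nakamura_slice l \<tau> M P 1
    by (rule nakamura_slice_1)
  show ?thesis
  proof (intro exI conjI ballI notI)
    show "special_lagrangian_family l \<tau> P {0<..<torus.period} torus.leaf"
      by (rule torus.special_lagrangian_family_leaf)
    show "special_lagrangian_family l \<tau> P {0<..<mapping_torus.period} mapping_torus.leaf"
      by (rule mapping_torus.special_lagrangian_family_leaf)
    fix s t
    assume "subtopology (nakamura l \<tau> P) (torus.leaf s) homeomorphic_space
      subtopology (nakamura l \<tau> P) (mapping_torus.leaf t)"
    then have "log_dependent (subtopology (nakamura l \<tau> P) (torus.leaf s))"
      using mapping_torus_log_dependent by (rule log_dependent_homeomorphic)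
    then show False
      using torus_not_log_dependent by contradiction
  qed
qed

end
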